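(* Let $G_1$ and $G_2$ be groups of finite centraliser dimension. (1) If $G_1\le G_2$ then $\mathrm{cdim}(G_1)\le \mathrm{cdim}(G_2)$. (2) The direct product satisfies $\mathrm{cdim}(G_1\times G_2)=\mathrm{cdim}(G_1)+\mathrm{cdim}(G_2)$. (3) The free product satisfies $$\mathrm{cdim}(G_1*G_2)=\max\{\mathrm{cdim}(G_1)+\mathtt{z}(G_1),\ \mathrm{cdim}(G_2)+\mathtt{z}(G_2)\}.$$ (4) Let $G_1$ and $G_2$ be non-Abelian groups with centres $Z(G_i)=Z_i$, $i=1,2$, such that $Z_1\cong Z_2\neq 1$, and let $G=G_1*_{Z_1=Z_2}G_2$. Then $$\mathrm{cdim}(G)=\max\{\mathrm{cdim}(G_1),\mathrm{cdim}(G_2)\}.$$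
   Context: For a subset $S$ of a group $G$, $C_G(S)=\{g\in G: gs=sg \text{ for all } s\in S\}$ is the centraliser of $S$ in $G$; a centraliser in $G$ is a subgroup of this form. A centraliser chain of length $k$ in $G$ is a sequence $C_0>C_1>\cdots>C_k$ of centralisers in $G$ with all inclusions strict. If there is an integer $d$ such that $G$ has a centraliser chain of length $d$ and none of length greater than $d$, then the centraliser dimension of $G$ is $\mathrm{cdim}(G)=d$; if no such $d$ exists, $\mathrm{cdim}(G)=\infty$. For a group $G$ with centre $Z(G)$, define $\mathtt{z}(G)=0$ if $Z(G)=1$ and $\mathtt{z}(G)=2$ otherwise. $G_1*G_2$ denotes the free product, and $G_1*_{Z_1=Z_2}G_2$ denotes the free product of $G_1$ and $G_2$ with $Z_1$ amalgamated with $Z_2$ via an isomorphism $Z_1\to Z_2$.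
   Formalization: In (3), the case where one factor is trivial and the other has non-trivial centre is excluded, since the formula fails there (for G_1 = 1 and G_2 = Z the left side is 0 and the right side is 2). *)

theory Defs
  imports "HOL-Algebra.Algebra" "HOL-Library.Extended_Nat"
begin

section \<open>Centralisers and centraliser dimension\<close>

definition centraliser :: "('a, 'm) monoid_scheme \<Rightarrow> 'a set \<Rightarrow> 'a set" where
  "centraliser G S = {g \<in> carrier G. \<forall>s\<in>S. g \<otimes>\<^bsub>G\<^esub> s = s \<otimes>\<^bsub>G\<^esub> g}"

definition centre :: "('a, 'm) monoid_scheme \<Rightarrow> 'a set" where
  "centre G = centraliser G (carrier G)"

definition is_centraliser :: "('a, 'm) monoid_scheme \<Rightarrow> 'a set \<Rightarrow> bool" where
  "is_centraliser G C \<longleftrightarrow> (\<exists>S. S \<subseteq> carrier G \<and> C = centraliser G S)"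

text \<open>A chain of length \<open>k\<close> has \<open>k + 1\<close> members \<open>C 0, \<dots>, C k\<close>;
  the values of \<open>C\<close> beyond \<open>k\<close> are irrelevant.\<close>

definition centraliser_chain :: "('a, 'm) monoid_scheme \<Rightarrow> nat \<Rightarrow> (nat \<Rightarrow> 'a set) \<Rightarrow> bool" where
  "centraliser_chain G k C \<longleftrightarrow>
     (\<forall>i\<le>k. is_centraliser G (C i)) \<and> (\<forall>i<k. C (Suc i) \<subset> C i)"

definition has_cdim :: "('a, 'm) monoid_scheme \<Rightarrow> nat \<Rightarrow> bool" where
  "has_cdim G d \<longleftrightarrow>
     (\<exists>C. centraliser_chain G d C) \<and> (\<forall>k>d. \<not> (\<exists>C. centraliser_chain G k C))"

definition cdim :: "('a, 'm) monoid_scheme \<Rightarrow> enat" where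
  "cdim G = (if \<exists>d. has_cdim G d then enat (THE d. has_cdim G d) else \<infinity>)"

definition zz :: "('a, 'm) monoid_scheme \<Rightarrow> enat" where
  "zz G = (if centre G = {\<one>\<^bsub>G\<^esub>} then 0 else 2)"

section \<open>Free products, with and without amalgamation\<close>

text \<open>The free product of \<open>G\<close> and \<open>H\<close> with identifications \<open>R\<close> is the set of words over the
  disjoint union of the carriers, modulo the congruence generated by multiplication and
  deletion of units within each factor and by \<open>x = y\<close> for \<open>(x, y) \<in> R\<close>.  As a monoid presentation
  this already gives a group: inverses of letters are present as letters.\<close>

definition words :: "('a, 'm) monoid_scheme \<Rightarrow> ('b, 'n) monoid_scheme \<Rightarrow> ('a + 'b) list set" where
  "words G H = lists (carrier G <+> carrier H)"

inductive word_eq ::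
    "('a, 'm) monoid_scheme \<Rightarrow> ('b, 'n) monoid_scheme \<Rightarrow> ('a \<times> 'b) set
      \<Rightarrow> ('a + 'b) list \<Rightarrow> ('a + 'b) list \<Rightarrow> bool"
  for G :: "('a, 'm) monoid_scheme" and H :: "('b, 'n) monoid_scheme" and R where
  refl: "u \<in> words G H \<Longrightarrow> word_eq G H R u u"
| sym: "word_eq G H R u v \<Longrightarrow> word_eq G H R v u"
| trans: "word_eq G H R u v \<Longrightarrow> word_eq G H R v w \<Longrightarrow> word_eq G H R u w"
| append: "word_eq G H R u u' \<Longrightarrow> word_eq G H R v v' \<Longrightarrow> word_eq G H R (u @ v) (u' @ v')"
| one_left: "word_eq G H R [Inl \<one>\<^bsub>G\<^esub>] []"
| one_right: "word_eq G H R [Inr \<one>\<^bsub>H\<^esub>] []"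
| mult_left: "x \<in> carrier G \<Longrightarrow> x' \<in> carrier G \<Longrightarrow>
    word_eq G H R [Inl x, Inl x'] [Inl (x \<otimes>\<^bsub>G\<^esub> x')]"
| mult_right: "y \<in> carrier H \<Longrightarrow> y' \<in> carrier H \<Longrightarrow>
    word_eq G H R [Inr y, Inr y'] [Inr (y \<otimes>\<^bsub>H\<^esub> y')]"
| amalg: "(x, y) \<in> R \<Longrightarrow> x \<in> carrier G \<Longrightarrow> y \<in> carrier H \<Longrightarrow>
    word_eq G H R [Inl x] [Inr y]"

definition word_rel ::
    "('a, 'm) monoid_scheme \<Rightarrow> ('b, 'n) monoid_scheme \<Rightarrow> ('a \<times> 'b) set
      \<Rightarrow> (('a + 'b) list \<times> ('a + 'b) list) set" where
  "word_rel G H R = {(u, v). word_eq G H R u v}"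

definition free_product_mod ::
    "('a, 'm) monoid_scheme \<Rightarrow> ('b, 'n) monoid_scheme \<Rightarrow> ('a \<times> 'b) set
      \<Rightarrow> ('a + 'b) list set monoid" where
  "free_product_mod G H R =
    \<lparr>carrier = words G H // word_rel G H R,
     monoid.mult = (\<lambda>U V. word_rel G H R `` {u @ v | u v. u \<in> U \<and> v \<in> V}),
     monoid.one = word_rel G H R `` {[]}\<rparr>"

definition free_product ::
    "('a, 'm) monoid_scheme \<Rightarrow> ('b, 'n) monoid_scheme \<Rightarrow> ('a + 'b) list set monoid" where
  "free_product G H = free_product_mod G H {}"

text \<open>Intended for a subgroup \<open>A\<close> of \<open>G\<close> and an isomorphism \<open>\<phi>\<close> from \<open>A\<close> onto a subgroup
  of \<open>H\<close>.\<close>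

definition amalgamated_product ::
    "('a, 'm) monoid_scheme \<Rightarrow> ('b, 'n) monoid_scheme \<Rightarrow> 'a set \<Rightarrow> ('a \<Rightarrow> 'b)
      \<Rightarrow> ('a + 'b) list set monoid" where
  "amalgamated_product G H A \<phi> = free_product_mod G H {(a, \<phi> a) | a. a \<in> A}"

lemma word_eq_words:
  assumes "word_eq G H R u v" "group G" "group H"
  shows "u \<in> words G H \<and> v \<in> words G H"
proof -
  interpret G: group G by fact
  interpret H: group H by fact
  show ?thesis using assms(1)
    by induction (auto simp: words_def)
qed

lemma equiv_word_rel:
  assumes "group G" "group H"
  shows "equiv (words G H) (word_rel G H R)"
  unfolding equiv_def refl_on_def sym_def trans_def word_rel_def
  using word_eq_words[OF _ assms] by (auto intro: word_eq.intros(1-3))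

lemma free_product_mod_mult:
  assumes "group G" "group H" "u \<in> words G H" "v \<in> words G H"
  shows "word_rel G H R `` {u} \<otimes>\<^bsub>free_product_mod G H R\<^esub> word_rel G H R `` {v}
    = word_rel G H R `` {u @ v}"
proof -
  have "word_eq G H R u u" "word_eq G H R v v"
    using assms by (auto intro: word_eq.refl)
  then show ?thesis
    unfolding free_product_mod_def word_rel_def
    by (auto intro: word_eq.sym word_eq.trans word_eq.append)
qed

theorem group_free_product_mod:
  assumes G: "group G" and H: "group H"
  shows "group (free_product_mod G H R)"
proof -
  interpret G: group G by fact
  interpret H: group H by fact
  let ?P = "free_product_mod G H R" and ?c = "\<lambda>u. word_rel G H R `` {u}"
  have car: "carrier ?P = ?c ` words G H"
    by (auto simp: free_product_mod_def quotient_def)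
  have one: "\<one>\<^bsub>?P\<^esub> = ?c []" by (simp add: free_product_mod_def)
  note mult = free_product_mod_mult[OF G H]
  have nil: "[] \<in> words G H" by (simp add: words_def)
  have app: "u @ v \<in> words G H" if "u \<in> words G H" "v \<in> words G H" for u v
    using that by (simp add: words_def)
  have cancel: "\<exists>v\<in>words G H. word_eq G H R (v @ u) []" if "u \<in> words G H" for u
    using that unfolding words_def
  proof (induction u)
    case Nil
    then show ?case by (intro bexI[of _ "[]"]) (auto intro: word_eq.refl simp: words_def)
  next
    case (Cons a u)
    then obtain v where v: "v \<in> lists (carrier G <+> carrier H)" "word_eq G H R (v @ u) []"
      by auto
    obtain b where b: "b \<in> carrier G <+> carrier H" "word_eq G H R [b, a] []"
    proof (cases a)
      case (Inl x)
      with Cons have x: "x \<in> carrier G" by auto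
      have "word_eq G H R [Inl (inv\<^bsub>G\<^esub> x), Inl x] []"
        using word_eq.mult_left[of "inv\<^bsub>G\<^esub> x" G x H R] word_eq.one_left[of G H R] x
        by (auto intro: word_eq.trans)
      with Inl x that[of "Inl (inv\<^bsub>G\<^esub> x)"] show ?thesis by auto
    next
      case (Inr x)
      with Cons have x: "x \<in> carrier H" by auto
      have "word_eq G H R [Inr (inv\<^bsub>H\<^esub> x), Inr x] []"
        using word_eq.mult_right[of "inv\<^bsub>H\<^esub> x" H x G R] word_eq.one_right[of G H R] x
        by (auto intro: word_eq.trans)
      with Inr x that[of "Inr (inv\<^bsub>H\<^esub> x)"] show ?thesis by auto
    qed
    have "word_eq G H R (v @ ([b, a] @ u)) (v @ ([] @ u))"
      using v b Cons by (intro word_eq.append word_eq.refl) (auto simp: words_def)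
    with v have "word_eq G H R ((v @ [b]) @ a # u) []" by (auto intro: word_eq.trans)
    with v b show ?case by (intro bexI[of _ "v @ [b]"]) auto
  qed
  show ?thesis
  proof (rule groupI)
    show "\<exists>y\<in>carrier ?P. y \<otimes>\<^bsub>?P\<^esub> x = \<one>\<^bsub>?P\<^esub>" if "x \<in> carrier ?P" for x
    proof -
      from that obtain u where u: "u \<in> words G H" "x = ?c u" by (auto simp: car)
      from cancel[OF u(1)] obtain v where v: "v \<in> words G H" "word_eq G H R (v @ u) []" by auto
      have "?c (v @ u) = ?c []"
        using v equiv_class_eq[OF equiv_word_rel[OF G H]] by (auto simp: word_rel_def)
      with u v show ?thesis by (auto simp: car mult one)
    qed
  qed (auto simp: car one mult app nil)
qed

end

theory Submission
  imports Defs
begin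

text \<open>A strict chain of \<open>k\<close> centralisers amounts to elements \<open>x\<^sub>i, y\<^sub>i\<close> with \<open>i < k\<close> such that \<open>y\<^sub>i\<close>
  commutes with every earlier \<open>x\<^sub>j\<close> but not with \<open>x\<^sub>i\<close> (a ladder). Ladders are carried along by
  injective homomorphisms, and a ladder in a direct product splits according to the coordinate that
  witnesses \<open>x\<^sub>i y\<^sub>i \<noteq> y\<^sub>i x\<^sub>i\<close>.

  The free product and the product with amalgamated centres are both products of two groups
  amalgamating a central subgroup \<open>Z\<close>. There the centraliser of an element of a factor outside \<open>Z\<close> lies in
  that factor, and the centraliser of an element that is not conjugate into a factor is abelian.
  Hence the first element \<open>x\<^sub>0\<close> of a ladder of length at least \<open>3\<close> is conjugate into a factor, after which
  all \<open>y\<^sub>i\<close> but the first and all \<open>x\<^sub>i\<close> but the last lie in that factor. The two missing elements can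
  be chosen in the factor as well if its centre is contained in \<open>Z\<close>; otherwise they account for the summand \<open>2\<close>.\<close>

section \<open>Ladders of commutators\<close>

text \<open>Three rungs are what it takes to exclude a hyperbolic \<open>x 0\<close>: then
  \<open>y 2\<close> is hyperbolic as well, and the abelian centralisers of \<open>y 2\<close> and
  \<open>x 0\<close> force first \<open>x 0, x 1\<close> and then \<open>x 1, y 1\<close> to
  commute. The summand 2 is attained by a central element of one factor, which commutes with a whole
  ladder of that factor and is played off at both ends against an element of the other factor. Such
  an element must exist: a trivial factor beside a factor with nontrivial centre breaks the formula
  for free products. Since \<open>Z\<close> is central, its elements can be collected in front of a
  word, and modulo \<open>Z\<close> the group is a free product of the quotients of the factors.
  Hence normal forms are compared only up to cosets of \<open>Z\<close> in each letter, which
  suffices for lengths and for commutation. The price is that the action on reduced words forgets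
  \<open>Z\<close> entirely, so that the embedding of the factors needs a second invariant, with
  values in the central product.\<close>

definition ladder :: "('a, 'm) monoid_scheme \<Rightarrow> nat set \<Rightarrow> (nat \<Rightarrow> 'a) \<Rightarrow> (nat \<Rightarrow> 'a) \<Rightarrow> bool" where
  "ladder G I x y \<longleftrightarrow>
     (\<forall>i\<in>I. x i \<in> carrier G \<and> y i \<in> carrier G \<and> y i \<otimes>\<^bsub>G\<^esub> x i \<noteq> x i \<otimes>\<^bsub>G\<^esub> y i) \<and>
     (\<forall>i\<in>I. \<forall>j\<in>I. j < i \<longrightarrow> y i \<otimes>\<^bsub>G\<^esub> x j = x j \<otimes>\<^bsub>G\<^esub> y i)"

lemma ladder_mono: "ladder G I x y \<Longrightarrow> J \<subseteq> I \<Longrightarrow> ladder G J x y"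
  unfolding ladder_def by (meson subsetD)

lemma ladder_reindex:
  assumes "ladder G I x y" "\<And>i. i \<in> J \<Longrightarrow> f i \<in> I"
    "\<And>i j. i \<in> J \<Longrightarrow> j \<in> J \<Longrightarrow> j < i \<Longrightarrow> f j < f i"
  shows "ladder G J (x \<circ> f) (y \<circ> f)"
  using assms unfolding ladder_def by auto

text \<open>Rungs may be dropped, so index sets with gaps arise, for instance when the rungs in a
  direct product are sorted by coordinate; listing \<open>I\<close> in increasing order closes the
  gaps.\<close>

lemma ladder_card:
  assumes "ladder G I x y" "finite I"
  shows "\<exists>x y. ladder G {..<card I} x y"
proof -
  let ?f = "\<lambda>i. sorted_list_of_set I ! i"
  have "ladder G {..<card I} (x \<circ> ?f) (y \<circ> ?f)"
  proof (rule ladder_reindex[OF assms(1)])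
    show "?f i \<in> I" if "i \<in> {..<card I}" for i
      using that assms(2) by (metis lessThan_iff nth_mem sorted_list_of_set.length_sorted_key_list_of_set
          sorted_list_of_set.set_sorted_key_list_of_set)
    show "?f j < ?f i" if "i \<in> {..<card I}" "j \<in> {..<card I}" "j < i" for i j
      using that strict_sorted_list_of_set[of I] assms(2)
      by (auto simp: sorted_wrt_iff_nth_less)
  qed
  then show ?thesis by blast
qed

text \<open>An element \<open>y i\<close> of \<open>C i\<close> outside \<open>C (Suc i)\<close>
  fails to commute with some \<open>x i\<close> in the set defining \<open>C (Suc i)\<close>, and
  the inclusions of the chain make it commute with all earlier \<open>x j\<close>. Conversely, the
  centralisers of the initial segments of \<open>x\<close> descend strictly.\<close>

lemma centraliser_chain_iff_ladder:
  "(\<exists>C. centraliser_chain G k C) \<longleftrightarrow> (\<exists>x y. ladder G {..<k} x y)"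
proof
  assume "\<exists>C. centraliser_chain G k C"
  then obtain C where C: "\<And>i. i \<le> k \<Longrightarrow> is_centraliser G (C i)"
    "\<And>i. i < k \<Longrightarrow> C (Suc i) \<subset> C i"
    unfolding centraliser_chain_def by blast
  have "\<exists>S. \<forall>i\<le>k. S i \<subseteq> carrier G \<and> C i = centraliser G (S i)"
    using C(1) unfolding is_centraliser_def by metis
  then obtain S where S: "\<And>i. i \<le> k \<Longrightarrow> S i \<subseteq> carrier G"
    "\<And>i. i \<le> k \<Longrightarrow> C i = centraliser G (S i)" by blast
  have anti: "C i \<subseteq> C j" if "j \<le> i" "i \<le> k" for i j
    using that
  proof (induction i rule: dec_induct)
    case (step n)
    then show ?case using C(2)[of n] by simp
  qed simp
  have "\<exists>x y. y \<in> C i \<and> x \<in> S (Suc i) \<and> y \<otimes>\<^bsub>G\<^esub> x \<noteq> x \<otimes>\<^bsub>G\<^esub> y" if i: "i < k" for i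
  proof -
    obtain y where y: "y \<in> C i" "y \<notin> C (Suc i)" using C(2)[OF i] by blast
    moreover have "y \<in> carrier G" using y S(2)[of i] i by (auto simp: centraliser_def)
    ultimately show ?thesis using S(2)[of "Suc i"] i by (auto simp: centraliser_def)
  qed
  then obtain x y where xy: "\<And>i. i < k \<Longrightarrow> y i \<in> C i" "\<And>i. i < k \<Longrightarrow> x i \<in> S (Suc i)"
    "\<And>i. i < k \<Longrightarrow> y i \<otimes>\<^bsub>G\<^esub> x i \<noteq> x i \<otimes>\<^bsub>G\<^esub> y i" by metis
  have "y i \<otimes>\<^bsub>G\<^esub> x j = x j \<otimes>\<^bsub>G\<^esub> y i" if "j < i" "i < k" for i j
  proof -
    have "y i \<in> C (Suc j)" using anti[of "Suc j" i] xy(1)[of i] that by auto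
    then show ?thesis using S(2)[of "Suc j"] xy(2)[of j] that by (auto simp: centraliser_def)
  qed
  moreover have "x i \<in> carrier G \<and> y i \<in> carrier G" if "i < k" for i
    using S(1)[of "Suc i"] S(2)[of i] xy(1,2)[OF that] that by (auto simp: centraliser_def)
  ultimately have "ladder G {..<k} x y" using xy(3) unfolding ladder_def by auto
  then show "\<exists>x y. ladder G {..<k} x y" by blast
next
  assume "\<exists>x y. ladder G {..<k} x y"
  then obtain x y where L: "ladder G {..<k} x y" by blast
  define C where "C i = centraliser G (x ` {..<i})" for i
  have "C (Suc i) \<subset> C i" if "i < k" for i
  proof
    show "C (Suc i) \<subseteq> C i" by (auto simp: C_def centraliser_def)
    have "y i \<in> C i" "y i \<notin> C (Suc i)"
      using L that by (auto simp: C_def centraliser_def ladder_def)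
    then show "C (Suc i) \<noteq> C i" by blast
  qed
  moreover have "is_centraliser G (C i)" if "i \<le> k" for i
    unfolding is_centraliser_def C_def
    by (intro exI[of _ "x ` {..<i}"]) (use L that in \<open>auto simp: ladder_def\<close>)
  ultimately show "\<exists>C. centraliser_chain G k C"
    unfolding centraliser_chain_def by blast
qed

section \<open>Centraliser dimension in terms of ladder lengths\<close>

lemma has_cdim_unique:
  assumes "has_cdim G d" "has_cdim G e"
  shows "d = e"
proof -
  have "\<not> d < e" "\<not> e < d" using assms unfolding has_cdim_def by blast+
  then show ?thesis by simp
qed

lemma has_cdim_imp_cdim:
  assumes "has_cdim G d"
  shows "cdim G = enat d"
proof -
  have "(THE d. has_cdim G d) = d" using assms has_cdim_unique[OF _ assms] by (rule the_equality)
  then show ?thesis using assms unfolding cdim_def by metis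
qed

text \<open>Infinite dimension is covered as well: a bounded nonempty set of ladder lengths has a
  greatest element, so \<open>has_cdim\<close> can fail for every \<open>d\<close> only if ladders
  of every length exist.\<close>

lemma enat_le_cdim_iff: "enat k \<le> cdim G \<longleftrightarrow> (\<exists>x y. ladder G {..<k} x y)"
proof (cases "\<exists>d. has_cdim G d")
  case True
  then obtain d where d: "has_cdim G d" by blast
  then obtain x y where "ladder G {..<d} x y"
    using centraliser_chain_iff_ladder[of G d] unfolding has_cdim_def by blast
  then have "\<exists>x y. ladder G {..<k} x y" if "k \<le> d"
    using ladder_mono[of G "{..<d}" x y "{..<k}"] that by auto
  moreover have "\<not> (\<exists>x y. ladder G {..<k} x y)" if "k > d"
    using d that centraliser_chain_iff_ladder[of G k] unfolding has_cdim_def by blast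
  ultimately show ?thesis using has_cdim_imp_cdim[OF d] by (metis enat_ord_simps(1) not_less)
next
  case False
  have "\<exists>x y. ladder G {..<k} x y"
  proof (rule ccontr)
    assume "\<not> ?thesis"
    then have no: "\<not> (\<exists>x y. ladder G {..<l} x y)" if "l \<ge> k" for l
      using ladder_mono[of G "{..<l}" _ _ "{..<k}"] that
      by (metis lessThan_subset_iff)
    let ?P = "\<lambda>l. \<exists>x y. ladder G {..<l} x y"
    have "?P 0" by (simp add: ladder_def)
    then obtain d where "?P d" "\<forall>l. ?P l \<longrightarrow> l \<le> d"
      using Greatest_le_nat[of ?P _ k] GreatestI_nat[of ?P 0 k] no by (meson nle_le)
    then have "has_cdim G d"
      unfolding has_cdim_def centraliser_chain_iff_ladder by (meson not_less)
    with False show False by blast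
  qed
  then show ?thesis using False by (simp add: cdim_def)
qed

lemma enat_le_cdimI: "ladder G I x y \<Longrightarrow> finite I \<Longrightarrow> enat (card I) \<le> cdim G"
  using ladder_card enat_le_cdim_iff by blast

text \<open>Testing against finite lower bounds turns estimates of \<open>cdim\<close> into
  constructions of ladders and hides the case of infinity.\<close>

lemma enat_le_imp_le:
  assumes "\<And>k. enat k \<le> c \<Longrightarrow> enat k \<le> d"
  shows "c \<le> (d :: enat)"
proof (cases c; cases d)
  fix n assume "c = \<infinity>" "d = enat n"
  then show ?thesis using assms[of "Suc n"] by simp
qed (use assms in auto)

lemma cdim_leI: "(\<And>k x y. ladder G {..<k} x y \<Longrightarrow> enat k \<le> d) \<Longrightarrow> cdim G \<le> d"
  by (rule enat_le_imp_le) (auto simp: enat_le_cdim_iff)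

text \<open>The pair is used twice with roles exchanged; the second rung only needs \<open>x\<close>
  to commute with itself.\<close>

lemma two_le_cdim:
  assumes "x \<in> carrier G" "y \<in> carrier G" "x \<otimes>\<^bsub>G\<^esub> y \<noteq> y \<otimes>\<^bsub>G\<^esub> x"
  shows "2 \<le> cdim G"
proof -
  have "ladder G {..<2} (\<lambda>i. if i = 0 then x else y) (\<lambda>i. if i = 0 then y else x)"
    using assms by (auto simp: ladder_def)
  then show ?thesis using enat_le_cdim_iff[of 2 G] by (metis numeral_eq_enat)
qed

lemma ladder_hom:
  assumes f: "f \<in> hom G H" "inj_on f (carrier G)" and G: "group G" and L: "ladder G I x y"
  shows "ladder H I (f \<circ> x) (f \<circ> y)"
proof -
  interpret group G by fact
  have "f u \<otimes>\<^bsub>H\<^esub> f v = f v \<otimes>\<^bsub>H\<^esub> f u \<longleftrightarrow> u \<otimes>\<^bsub>G\<^esub> v = v \<otimes>\<^bsub>G\<^esub> u"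
    if "u \<in> carrier G" "v \<in> carrier G" for u v
    using that f by (metis hom_mult inj_onD m_closed)
  then show ?thesis using L f(1) unfolding ladder_def hom_def by (auto simp: Pi_iff)
qed

lemma cdim_mono_hom:
  assumes "f \<in> hom G H" "inj_on f (carrier G)" "group G"
  shows "cdim G \<le> cdim H"
proof (rule cdim_leI)
  fix k x y assume "ladder G {..<k} x y"
  from ladder_hom[OF assms this] show "enat k \<le> cdim H" unfolding enat_le_cdim_iff by blast
qed

lemma cdim_mono_is_iso:
  assumes "G \<cong> H" "group G"
  shows "cdim G \<le> cdim H"
  using assms cdim_mono_hom[of _ G H] unfolding is_iso_def iso_def bij_betw_def by blast

lemma cdim_mono_subgroup:
  assumes "group G" "subgroup H G"
  shows "cdim (G\<lparr>carrier := H\<rparr>) \<le> cdim G"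
  using assms
  by (intro cdim_mono_hom[of id] group.subgroup_imp_group)
    (auto simp: hom_def subgroup.mem_carrier)

lemma cdim_DirProd:
  assumes "group G" "group H"
  shows "cdim (G \<times>\<times> H) = cdim G + cdim H"
proof (rule antisym)
  interpret G: group G by fact
  interpret H: group H by fact
  show "cdim (G \<times>\<times> H) \<le> cdim G + cdim H"
  proof (rule cdim_leI)
    fix k x y assume L: "ladder (G \<times>\<times> H) {..<k} x y"
    \<comment> \<open>Outside \<open>I\<close> the first coordinates commute, so there the second
      coordinates must be the ones that do not.\<close>
    define I where "I = {i. i < k \<and> fst (y i) \<otimes>\<^bsub>G\<^esub> fst (x i) \<noteq> fst (x i) \<otimes>\<^bsub>G\<^esub> fst (y i)}"
    have fin: "finite I" "I \<subseteq> {..<k}" unfolding I_def by auto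
    have prod: "u \<otimes>\<^bsub>G \<times>\<times> H\<^esub> v = (fst u \<otimes>\<^bsub>G\<^esub> fst v, snd u \<otimes>\<^bsub>H\<^esub> snd v)" for u v
      by (cases u; cases v) simp
    have "ladder G I (fst \<circ> x) (fst \<circ> y)"
      using L unfolding ladder_def I_def prod by (auto simp: mem_Times_iff)
    then have 1: "enat (card I) \<le> cdim G" using fin by (intro enat_le_cdimI)
    have "ladder H ({..<k} - I) (snd \<circ> x) (snd \<circ> y)"
      using L unfolding ladder_def I_def prod by (auto simp: mem_Times_iff)
    then have "enat (card ({..<k} - I)) \<le> cdim H" by (intro enat_le_cdimI) auto
    moreover have "k = card I + card ({..<k} - I)"
      using fin card_mono[OF _ fin(2)] by (simp add: card_Diff_subset)
    ultimately show "enat k \<le> cdim G + cdim H"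
      using 1 add_mono by (metis plus_enat_simps(1))
  qed
  have sum: "enat (k + l) \<le> cdim (G \<times>\<times> H)" if kl: "enat k \<le> cdim G" "enat l \<le> cdim H" for k l
  proof -
    obtain x y x' y' where L: "ladder G {..<k} x y" "ladder H {..<l} x' y'"
      using kl unfolding enat_le_cdim_iff by blast
    \<comment> \<open>A ladder of the second factor is stacked on one of the first, with units in
      the missing coordinate; elements of different factors commute.\<close>
    let ?c = "\<lambda>x x' i. if i < k then (x i, \<one>\<^bsub>H\<^esub>) else (\<one>\<^bsub>G\<^esub>, x' (i - k))"
    have "ladder (G \<times>\<times> H) {..<k + l} (?c x x') (?c y y')"
      using L unfolding ladder_def by (auto simp: less_diff_conv2 diff_less_mono)
    then show ?thesis using enat_le_cdim_iff by blast
  qed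
  show "cdim G + cdim H \<le> cdim (G \<times>\<times> H)"
  proof (rule enat_le_imp_le)
    fix n assume n: "enat n \<le> cdim G + cdim H"
    \<comment> \<open>The bound \<open>n\<close> is divided between the summands; an infinite first
      summand takes all of it.\<close>
    have "\<exists>k l. n = k + l \<and> enat k \<le> cdim G \<and> enat l \<le> cdim H"
    proof (cases "cdim G")
      case k: (enat k)
      show ?thesis
      proof (cases "n \<le> k")
        case True
        then show ?thesis using k by (intro exI[of _ n] exI[of _ 0]) (simp flip: zero_enat_def)
      next
        case False
        then have "enat (n - k) \<le> cdim H" using n k by (cases "cdim H") auto
        then show ?thesis using k False by (intro exI[of _ k] exI[of _ "n - k"]) auto
      qed
    next
      case infinity
      then show ?thesis by (intro exI[of _ n] exI[of _ 0]) (simp flip: zero_enat_def)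
    qed
    then show "enat n \<le> cdim (G \<times>\<times> H)" using sum by blast
  qed
qed

lemma centreD: "z \<in> centre G \<Longrightarrow> x \<in> carrier G \<Longrightarrow> z \<otimes>\<^bsub>G\<^esub> x = x \<otimes>\<^bsub>G\<^esub> z"
  unfolding centre_def centraliser_def by blast

lemma noncentral_commute:
  assumes "x \<in> carrier G" "x \<notin> centre G"
  shows "\<exists>y\<in>carrier G. x \<otimes>\<^bsub>G\<^esub> y \<noteq> y \<otimes>\<^bsub>G\<^esub> x"
  using assms unfolding centre_def centraliser_def by blast

lemma two_le_cdim_noncentral: "x \<in> carrier G \<Longrightarrow> x \<notin> centre G \<Longrightarrow> 2 \<le> cdim G"
  using noncentral_commute two_le_cdim by metis

section \<open>Central amalgams\<close>

text \<open>Both \<open>u @ v\<close> and \<open>v @ u\<close> commute with \<open>w\<close>, hence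
  with all powers of \<open>w\<close>, so each is a prefix of any sufficiently long power; having
  equal length, they coincide.\<close>

lemma append_commute_trans:
  assumes "u @ w = w @ u" "v @ w = w @ v" "w \<noteq> []"
  shows "u @ v = v @ u"
proof -
  let ?p = "\<lambda>k. concat (replicate k w)"
  have com: "h @ ?p k = ?p k @ h" if "h @ w = w @ h" for h k
  proof (induction k)
    case (Suc k)
    have "h @ w @ ?p k = w @ h @ ?p k" using that by (metis append.assoc)
    then show ?case using Suc by simp
  qed simp
  have len: "k \<le> length (?p k)" for k
    using assms(3) by (induction k) (auto simp: Suc_le_eq neq_Nil_conv)
  have pre: "h = take (length h) (?p k)" if "h @ w = w @ h" "length h \<le> k" for h k
  proof -
    have "take (length h) (h @ ?p k) = take (length h) (?p k @ h)" using com[OF that(1)] by simp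
    then show ?thesis using len[of k] that(2) by simp
  qed
  have "(u @ v) @ w = w @ (u @ v)" "(v @ u) @ w = w @ (v @ u)"
    using assms by (metis append.assoc)+
  from pre[OF this(1), of "length u + length v"] pre[OF this(2), of "length u + length v"]
  show ?thesis by (simp add: add.commute)
qed

section \<open>Commutation, conjugation and products of words in a group\<close>

context group
begin

lemma cancel_inv [simp]:
  assumes "x \<in> carrier G" "y \<in> carrier G"
  shows "inv x \<otimes> (x \<otimes> y) = y" "x \<otimes> (inv x \<otimes> y) = y"
  using assms by (simp_all flip: m_assoc)

lemma commute_mult:
  assumes "x \<in> carrier G" "y \<in> carrier G" "s \<in> carrier G" "x \<otimes> s = s \<otimes> x" "y \<otimes> s = s \<otimes> y"
  shows "(x \<otimes> y) \<otimes> s = s \<otimes> (x \<otimes> y)"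
  using assms by (metis m_assoc)

lemma commute_pow:
  assumes "x \<in> carrier G" "s \<in> carrier G" "x \<otimes> s = s \<otimes> x"
  shows "x [^] (n::nat) \<otimes> s = s \<otimes> x [^] n"
  by (induction n) (use assms commute_mult in auto)

lemma commute_cancel_right:
  assumes "x \<in> carrier G" "y \<in> carrier G" "s \<in> carrier G"
    "(x \<otimes> y) \<otimes> s = s \<otimes> (x \<otimes> y)" "y \<otimes> s = s \<otimes> y"
  shows "x \<otimes> s = s \<otimes> x"
proof -
  have "(x \<otimes> s) \<otimes> y = (s \<otimes> x) \<otimes> y" using assms by (metis m_assoc)
  then show ?thesis using assms by (metis m_closed r_cancel)
qed

definition conjugate :: "'a \<Rightarrow> 'a \<Rightarrow> 'a" where "conjugate c x = c \<otimes> x \<otimes> inv c"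

lemma conjugate_closed [simp]: "c \<in> carrier G \<Longrightarrow> x \<in> carrier G \<Longrightarrow> conjugate c x \<in> carrier G"
  by (simp add: conjugate_def)

lemma conjugate_mult:
  "c \<in> carrier G \<Longrightarrow> x \<in> carrier G \<Longrightarrow> y \<in> carrier G \<Longrightarrow> conjugate c (x \<otimes> y) = conjugate c x \<otimes> conjugate c y"
  by (simp add: conjugate_def m_assoc inv_solve_left)

lemma conjugate_conjugate:
  "c \<in> carrier G \<Longrightarrow> d \<in> carrier G \<Longrightarrow> x \<in> carrier G \<Longrightarrow> conjugate c (conjugate d x) = conjugate (c \<otimes> d) x"
  by (simp add: conjugate_def m_assoc inv_mult_group)

lemma conjugate_inj:
  assumes "c \<in> carrier G" "x \<in> carrier G" "y \<in> carrier G"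
  shows "conjugate c x = conjugate c y \<longleftrightarrow> x = y"
  using assms by (simp add: conjugate_def)

lemma ladder_conjugate:
  assumes "c \<in> carrier G" "ladder G I x y"
  shows "ladder G I (conjugate c \<circ> x) (conjugate c \<circ> y)"
  using assms(1) by (intro ladder_hom[OF _ _ is_group assms(2)])
    (auto simp: hom_def conjugate_mult inj_on_def conjugate_inj)

definition word_prod :: "'a list \<Rightarrow> 'a" where "word_prod u = foldr (\<otimes>) u \<one>"

lemma word_prod_simps [simp]: "word_prod [] = \<one>" "word_prod (x # u) = x \<otimes> word_prod u"
  by (simp_all add: word_prod_def)

lemma word_prod_closed [simp]: "set u \<subseteq> carrier G \<Longrightarrow> word_prod u \<in> carrier G"
  by (induction u) auto

lemma word_prod_append:
  "set u \<subseteq> carrier G \<Longrightarrow> set v \<subseteq> carrier G \<Longrightarrow> word_prod (u @ v) = word_prod u \<otimes> word_prod v"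
  by (induction u) (auto simp: m_assoc)

end

section \<open>Transport to the image of an embedding\<close>

lemma centre_hom_image:
  assumes f: "f \<in> hom G H" "inj_on f (carrier G)" and G: "group G"
  shows "centre (H\<lparr>carrier := f ` carrier G\<rparr>) = f ` centre G"
proof -
  interpret group G by fact
  have "f u \<otimes>\<^bsub>H\<^esub> f v = f v \<otimes>\<^bsub>H\<^esub> f u \<longleftrightarrow> u \<otimes>\<^bsub>G\<^esub> v = v \<otimes>\<^bsub>G\<^esub> u"
    if "u \<in> carrier G" "v \<in> carrier G" for u v
    using that f by (metis hom_mult inj_onD m_closed)
  then show ?thesis by (auto simp: centre_def centraliser_def)
qed

lemma cdim_hom_image:
  assumes f: "f \<in> hom G H" "inj_on f (carrier G)" and G: "group G" and H: "group H"
  shows "cdim (H\<lparr>carrier := f ` carrier G\<rparr>) = cdim G"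
proof -
  interpret group_hom G H f using assms by (simp add: group_hom_def group_hom_axioms_def)
  have "f \<in> iso G (H\<lparr>carrier := f ` carrier G\<rparr>)"
    using f by (auto simp: iso_def hom_def bij_betw_def)
  then have iso: "G \<cong> H\<lparr>carrier := f ` carrier G\<rparr>" by (auto simp: is_iso_def)
  moreover have "group (H\<lparr>carrier := f ` carrier G\<rparr>)"
    using img_is_subgroup H group.subgroup_imp_group by blast
  ultimately show ?thesis
    using cdim_mono_is_iso[OF iso G] cdim_mono_is_iso[OF group.iso_sym[OF G iso]] by simp
qed

lemma zz_hom_image:
  assumes f: "f \<in> hom G H" "inj_on f (carrier G)" and G: "group G" and H: "group H"
  shows "zz (H\<lparr>carrier := f ` carrier G\<rparr>) = zz G"
proof -
  interpret group_hom G H f using assms by (simp add: group_hom_def group_hom_axioms_def)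
  have "f ` centre G = {\<one>\<^bsub>H\<^esub>} \<longleftrightarrow> centre G = {\<one>\<^bsub>G\<^esub>}"
  proof
    assume "f ` centre G = {\<one>\<^bsub>H\<^esub>}"
    then have "f ` centre G = f ` {\<one>\<^bsub>G\<^esub>}" by simp
    moreover have "centre G \<subseteq> carrier G" by (auto simp: centre_def centraliser_def)
    ultimately show "centre G = {\<one>\<^bsub>G\<^esub>}" using inj_on_image_eq_iff[OF f(2), of "centre G" "{\<one>\<^bsub>G\<^esub>}"] by simp
  qed simp
  then show ?thesis by (simp add: zz_def centre_hom_image[OF f G])
qed

lemma subgroup_centre:
  assumes "group G"
  shows "subgroup (centre G) G"
proof -
  interpret group G by fact
  have iff: "z \<in> centre G \<longleftrightarrow> z \<in> carrier G \<and> (\<forall>x\<in>carrier G. z \<otimes>\<^bsub>G\<^esub> x = x \<otimes>\<^bsub>G\<^esub> z)" for z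
    by (auto simp: centre_def centraliser_def)
  show ?thesis
  proof (rule subgroupI)
    show "centre G \<noteq> {}" using iff[of "\<one>\<^bsub>G\<^esub>"] by auto
    fix x assume x: "x \<in> centre G"
    then have "inv\<^bsub>G\<^esub> x \<otimes>\<^bsub>G\<^esub> y = y \<otimes>\<^bsub>G\<^esub> inv\<^bsub>G\<^esub> x" if "y \<in> carrier G" for y
      using commute_cancel_right[of "inv\<^bsub>G\<^esub> x" x y] iff[of x] that by simp
    then show "inv\<^bsub>G\<^esub> x \<in> centre G" using x iff by simp
    fix y assume "y \<in> centre G"
    then have "(x \<otimes>\<^bsub>G\<^esub> y) \<otimes>\<^bsub>G\<^esub> s = s \<otimes>\<^bsub>G\<^esub> (x \<otimes>\<^bsub>G\<^esub> y)" if "s \<in> carrier G" for s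
      using commute_mult[of x y s] x iff that by blast
    moreover have "x \<otimes>\<^bsub>G\<^esub> y \<in> carrier G" using x \<open>y \<in> centre G\<close> iff by blast
    ultimately show "x \<otimes>\<^bsub>G\<^esub> y \<in> centre G" using iff by blast
  qed (use iff in blast)
qed

lemma noncentral_element: "group G \<Longrightarrow> \<not> comm_group G \<Longrightarrow> \<exists>x\<in>carrier G. x \<notin> centre G"
  using group.group_comm_groupI[of G] centreD[of _ G] by blast

section \<open>Alternating words and central amalgams\<close>

fun alternating :: "(bool \<Rightarrow> 'a set) \<Rightarrow> bool \<Rightarrow> 'a list \<Rightarrow> bool" where
  "alternating L i [] = True"
| "alternating L i (x # u) = (x \<in> L i \<and> alternating L (\<not> i) u)"

text \<open>The index is flipped once per letter, so it is back at \<open>i\<close> after an even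
  number of letters and at \<open>\<not> i\<close> otherwise; the equation of booleans
  \<open>i = even (length u)\<close> encodes this.\<close>

lemma alternating_append:
  "alternating L i (u @ v) \<longleftrightarrow> alternating L i u \<and> alternating L (i = even (length u)) v"
proof (induction u arbitrary: i)
  case (Cons x u)
  then show ?case by (cases "even (length u)") simp_all
qed simp

lemma alternating_set: "alternating L i u \<Longrightarrow> set u \<subseteq> L True \<union> L False"
proof (induction u arbitrary: i)
  case (Cons x u)
  then show ?case using Cons.IH[of "\<not> i"] by (cases i) auto
qed simp

text \<open>Free products and amalgams over centres are treated at once.
  \<open>letters_unique\<close> determines letters only up to cosets of \<open>Z\<close>, since a
  central element may be moved from one letter to another; \<open>z\<close> takes up the
  discrepancy.\<close>

locale central_amalgam = group G for G (structure) +
  fixes H :: "bool \<Rightarrow> 'a set" and Z :: "'a set"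
  assumes H_subgroup: "subgroup (H i) G"
    and Z_subgroup: "subgroup Z G"
    and Z_subset: "Z \<subseteq> H i"
    and H_Int: "H True \<inter> H False \<subseteq> Z"
    and Z_commute: "z \<in> Z \<Longrightarrow> g \<in> carrier G \<Longrightarrow> z \<otimes> g = g \<otimes> z"
    and generated: "g \<in> carrier G \<Longrightarrow> \<exists>u. set u \<subseteq> H True \<union> H False \<and> g = word_prod u"
    and letters_unique: "alternating (\<lambda>i. H i - Z) i u \<Longrightarrow> alternating (\<lambda>i. H i - Z) j v \<Longrightarrow> z \<in> Z \<Longrightarrow>
      word_prod u = z \<otimes> word_prod v \<Longrightarrow> map (r_coset G Z) u = map (r_coset G Z) v"
begin

lemma H_carrier: "x \<in> H i \<Longrightarrow> x \<in> carrier G"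
  using H_subgroup subgroup.mem_carrier by metis

lemma Z_carrier: "x \<in> Z \<Longrightarrow> x \<in> carrier G"
  using Z_subgroup subgroup.mem_carrier by metis

lemma H_mult: "x \<in> H i \<Longrightarrow> y \<in> H i \<Longrightarrow> x \<otimes> y \<in> H i"
  using H_subgroup subgroup.m_closed by metis

lemma H_inv: "x \<in> H i \<Longrightarrow> inv x \<in> H i"
  using H_subgroup subgroup.m_inv_closed by metis

lemma Z_mult: "x \<in> Z \<Longrightarrow> y \<in> Z \<Longrightarrow> x \<otimes> y \<in> Z"
  using Z_subgroup subgroup.m_closed by metis

lemma Z_inv: "x \<in> Z \<Longrightarrow> inv x \<in> Z"
  using Z_subgroup subgroup.m_inv_closed by metis

lemma Z_one: "\<one> \<in> Z"
  using Z_subgroup subgroup.one_closed by metis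

lemma Z_mult_left_iff: "z \<in> Z \<Longrightarrow> x \<in> carrier G \<Longrightarrow> z \<otimes> x \<in> Z \<longleftrightarrow> x \<in> Z"
  by (metis Z_carrier Z_inv Z_mult Z_subgroup inv_solve_left m_closed)

lemma HD_disjoint: "x \<in> H i - Z \<Longrightarrow> x \<notin> H (\<not> i)"
  using H_Int by (cases i) auto

lemma alternating_carrier: "alternating (\<lambda>i. H i - Z) i u \<Longrightarrow> set u \<subseteq> carrier G"
  using alternating_set[of "\<lambda>i. H i - Z" i u] H_carrier by blast

section \<open>Normal forms and their lengths\<close>

text \<open>For \<open>n = 0\<close> the index \<open>i\<close> carries no information, which is
  exploited by choosing it freely; for \<open>n > 0\<close> the last letter lies in the factor
  opposite to \<open>i = even n\<close>.\<close>

definition form :: "'a \<Rightarrow> bool \<Rightarrow> nat \<Rightarrow> bool" where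
  "form g i n \<longleftrightarrow> (\<exists>z u. z \<in> Z \<and> alternating (\<lambda>i. H i - Z) i u \<and> length u = n \<and> g = z \<otimes> word_prod u)"

lemma form_carrier: "form g i n \<Longrightarrow> g \<in> carrier G"
  unfolding form_def using alternating_carrier Z_carrier by auto

lemma form_0_iff: "form g i 0 \<longleftrightarrow> g \<in> Z"
  unfolding form_def using Z_carrier by force

lemma form_1: "g \<in> H i - Z \<Longrightarrow> form g i 1"
  unfolding form_def using Z_one H_carrier
  by (intro exI[of _ \<one>] exI[of _ "[g]"]) auto

text \<open>A letter following a word of length \<open>n\<close> that starts in factor \<open>i\<close> continues it if it lies in
  factor \<^term>\<open>i = even n\<close>.\<close>

lemma form_mult:
  assumes "form g i n" "form h (i = even n) m"
  shows "form (g \<otimes> h) i (n + m)"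
proof -
  obtain z u where u: "z \<in> Z" "alternating (\<lambda>i. H i - Z) i u" "length u = n" "g = z \<otimes> word_prod u"
    using assms(1) unfolding form_def by blast
  obtain y v where v: "y \<in> Z" "alternating (\<lambda>i. H i - Z) (i = even n) v" "length v = m" "h = y \<otimes> word_prod v"
    using assms(2) unfolding form_def by blast
  note [simp] = alternating_carrier[OF u(2)] alternating_carrier[OF v(2)] Z_carrier[OF u(1)] Z_carrier[OF v(1)]
  have "g \<otimes> h = z \<otimes> ((word_prod u \<otimes> y) \<otimes> word_prod v)" by (simp add: u v m_assoc)
  also have "word_prod u \<otimes> y = y \<otimes> word_prod u" using Z_commute[OF v(1), of "word_prod u"] by simp
  finally have "g \<otimes> h = (z \<otimes> y) \<otimes> word_prod (u @ v)" by (simp add: word_prod_append m_assoc)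
  moreover have "z \<otimes> y \<in> Z" using Z_mult u v by auto
  ultimately show ?thesis
    unfolding form_def using u v by (intro exI[of _ "z \<otimes> y"] exI[of _ "u @ v"]) (auto simp: alternating_append)
qed

lemma form_Z_mult: "z \<in> Z \<Longrightarrow> form g i n \<Longrightarrow> form (z \<otimes> g) i n"
  using form_mult[of z i 0 g n] by (simp add: form_0_iff)

lemma form_split:
  assumes "form g i (n + m)"
  obtains h k where "form h i n" "form k (i = even n) m" "g = h \<otimes> k"
proof -
  obtain z u where u: "z \<in> Z" "alternating (\<lambda>i. H i - Z) i u" "length u = n + m" "g = z \<otimes> word_prod u"
    using assms unfolding form_def by blast
  define v w where vw: "v = take n u" "w = drop n u"
  have l: "length v = n" "length w = m" "u = v @ w" using u by (auto simp: vw)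
  have a: "alternating (\<lambda>i. H i - Z) i v" "alternating (\<lambda>i. H i - Z) (i = even n) w"
    using u(2) l by (auto simp: alternating_append)
  note [simp] = alternating_carrier[OF a(1)] alternating_carrier[OF a(2)] Z_carrier[OF u(1)]
  show ?thesis
  proof
    show "form (z \<otimes> word_prod v) i n" unfolding form_def using a l u by blast
    show "form (word_prod w) (i = even n) m" unfolding form_def using a l Z_one
      by (intro exI[of _ \<one>] exI[of _ w]) auto
    show "g = (z \<otimes> word_prod v) \<otimes> word_prod w" by (simp add: u l(3) word_prod_append m_assoc)
  qed
qed

lemma form_1D: "form g i 1 \<Longrightarrow> g \<in> H i - Z"
proof -
  assume "form g i 1"
  then obtain z x where zx: "z \<in> Z" "x \<in> H i - Z" "g = z \<otimes> x"
    unfolding form_def by (auto simp: length_Suc_conv H_carrier)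
  then show ?thesis using Z_mult_left_iff[of z x] H_mult[of z i x] Z_subset H_carrier by auto
qed

text \<open>Equal lists of cosets have equal lengths. The first letters \<open>a\<close> and
  \<open>b\<close> differ by an element of \<open>Z\<close>, so \<open>a\<close> lies in
  \<open>H j\<close> as well as in \<open>H i\<close>, and outside \<open>Z\<close> this forces
  \<open>i = j\<close>.\<close>

lemma form_unique:
  assumes "form g i n" "form g j m"
  shows "n = m \<and> (n > 0 \<longrightarrow> i = j)"
proof -
  obtain z u where u: "z \<in> Z" "alternating (\<lambda>i. H i - Z) i u" "length u = n" "g = z \<otimes> word_prod u"
    using assms(1) unfolding form_def by blast
  obtain y v where v: "y \<in> Z" "alternating (\<lambda>i. H i - Z) j v" "length v = m" "g = y \<otimes> word_prod v"
    using assms(2) unfolding form_def by blast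
  note [simp] = alternating_carrier[OF u(2)] alternating_carrier[OF v(2)] Z_carrier[OF u(1)] Z_carrier[OF v(1)]
  have "word_prod u = (inv z \<otimes> y) \<otimes> word_prod v"
    using u(4) v(4) by (simp add: inv_solve_left m_assoc)
  from letters_unique[OF u(2) v(2) _ this] have eq: "map (r_coset G Z) u = map (r_coset G Z) v"
    using Z_mult Z_inv u v by blast
  then have "n = m" using u v by (metis length_map)
  moreover have "i = j" if pos: "n > 0"
  proof -
    obtain a u' b v' where ab: "u = a # u'" "v = b # v'" "a \<in> H i - Z" "b \<in> H j - Z"
      using pos u v \<open>n = m\<close> by (cases u; cases v) auto
    then have "a \<in> Z #> b" using eq Z_subgroup H_carrier[of a i]
      by (metis DiffD1 list.inject list.map(2) rcos_self)
    then obtain c where "c \<in> Z" "a = c \<otimes> b" by (auto simp: r_coset_def)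
    then have "a \<in> H j" using H_mult Z_subset ab by blast
    then show ?thesis using HD_disjoint[OF ab(3)] by (cases "i = j") auto
  qed
  ultimately show ?thesis by blast
qed

text \<open>The letter \<open>x\<close> is prepended, merges with the first letter or cancels it.
  The clause with \<open>even\<close> says that the factor of the last letter is untouched; if
  everything cancels, the then free index is set to \<open>\<not> i\<close> to keep the clause
  true.\<close>

lemma form_mult_left:
  assumes "x \<in> H i" "form g j n"
  shows "\<exists>j' n'. form (x \<otimes> g) j' n' \<and> n \<le> n' + 1 \<and> n' \<le> n + 1 \<and> (j = i \<and> n > 0 \<longrightarrow> n' \<le> n) \<and>
    (n > 0 \<longrightarrow> (j' = even n') = (j = even n))"
proof (cases "x \<in> Z \<or> n = 0 \<or> j \<noteq> i")
  case True
  then consider "x \<in> Z" | "x \<notin> Z" "n = 0" | "x \<notin> Z" "j \<noteq> i" by blast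
  then show ?thesis
  proof cases
    case 1
    then show ?thesis using form_Z_mult[OF 1 assms(2)] by (intro exI[of _ j] exI[of _ n]) auto
  next
    case 2
    then have "form (g \<otimes> x) i (0 + 1)"
      using form_mult[of g i 0 x 1] form_1[of x i] assms form_0_iff[of g] by auto
    moreover have "g \<otimes> x = x \<otimes> g" using 2 assms Z_commute H_carrier form_0_iff by metis
    ultimately show ?thesis using 2
      by (intro exI[of _ i] exI[of _ 1]) auto
  next
    case 3
    then have "form (x \<otimes> g) i (1 + n)" using form_mult[of x i 1 g n] form_1[of x i] assms by auto
    then show ?thesis using 3 by (intro exI[of _ i] exI[of _ "1 + n"]) auto
  qed
next
  case False
  then obtain m where n: "n = 1 + m" by (cases n) auto
  then obtain h k where hk: "form h i 1" "form k (\<not> i) m" "g = h \<otimes> k"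
    using form_split[of g i 1 m] False assms by auto
  have car: "x \<in> carrier G" "h \<in> carrier G" "k \<in> carrier G"
    using hk form_carrier assms H_carrier by blast+
  then have eq: "x \<otimes> g = (x \<otimes> h) \<otimes> k" by (simp add: hk m_assoc)
  have xh: "x \<otimes> h \<in> H i" using assms form_1D[OF hk(1)] H_mult by blast
  show ?thesis
  proof (cases "x \<otimes> h \<in> Z")
    case True
    then have "form (x \<otimes> g) (\<not> i) m" using eq hk form_Z_mult by simp
    then show ?thesis using n False by (intro exI[of _ "\<not> i"] exI[of _ m]) auto
  next
    case False': False
    then have "form (x \<otimes> g) i (1 + m)" using eq hk xh form_mult[of "x \<otimes> h" i 1 k m] form_1 by auto
    then show ?thesis using n False by (intro exI[of _ i] exI[of _ n]) auto
  qed
qed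

lemma form_mult_right:
  assumes "x \<in> H i" "form g j n" "n > 0"
  shows "\<exists>n'. form (g \<otimes> x) j n' \<and> n \<le> n' + 1"
proof -
  obtain m where n: "n = m + 1" using assms(3) by (cases n) auto
  then obtain h k where hk: "form h j m" "form k (j = even m) 1" "g = h \<otimes> k"
    using form_split[of g j m 1] assms by auto
  have car: "x \<in> carrier G" "h \<in> carrier G" "k \<in> carrier G"
    using hk form_carrier assms H_carrier by blast+
  then have eq: "g \<otimes> x = h \<otimes> (k \<otimes> x)" by (simp add: hk m_assoc)
  consider "x \<in> Z" | "x \<notin> Z" "i = (j = even n)" | "x \<notin> Z" "i = (j = even m)" using n by auto
  then show ?thesis
  proof cases
    case 1
    then have "form (g \<otimes> x) j n" using form_Z_mult[OF 1 assms(2)] Z_commute form_carrier[OF assms(2)] by simp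
    then show ?thesis by auto
  next
    case 2
    then have "form (g \<otimes> x) j (n + 1)" using form_mult[OF assms(2), of x 1] form_1[of x i] assms by auto
    then show ?thesis by force
  next
    case 3
    then have kx: "k \<otimes> x \<in> H i" using assms form_1D[OF hk(2)] H_mult by blast
    show ?thesis
    proof (cases "k \<otimes> x \<in> Z")
      case True
      then have "form (g \<otimes> x) j m" using eq hk form_Z_mult Z_commute car by metis
      then show ?thesis using n by auto
    next
      case False
      then have "form (g \<otimes> x) j (m + 1)" using eq hk kx 3 form_mult[OF hk(1), of "k \<otimes> x" 1] form_1[of "k \<otimes> x" i] by auto
      then show ?thesis using n by auto
    qed
  qed
qed

lemma set_carrier: "set u \<subseteq> H True \<union> H False \<Longrightarrow> set u \<subseteq> carrier G"
  using H_carrier by blast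

text \<open>Each letter of \<open>u\<close> removes at most one letter of \<open>g\<close>, so with
  \<open>length u < n\<close> the last letter of \<open>g\<close> is never cancelled and its factor
  survives.\<close>

lemma form_word_mult_left:
  assumes "set u \<subseteq> H True \<union> H False" "form g j n" "length u < n"
  shows "\<exists>j' n'. form (word_prod u \<otimes> g) j' n' \<and> n \<le> n' + length u \<and> (j' = even n') = (j = even n)"
  using assms
proof (induction u)
  case Nil
  then show ?case using form_carrier by (intro exI[of _ j] exI[of _ n]) auto
next
  case (Cons x u)
  then obtain j' n' where 1: "form (word_prod u \<otimes> g) j' n'" "n \<le> n' + length u" "(j' = even n') = (j = even n)"
    by auto
  obtain i where i: "x \<in> H i" using Cons by auto
  have "n' > 0" using 1 Cons by auto
  then obtain j'' n'' where 2: "form (x \<otimes> (word_prod u \<otimes> g)) j'' n''" "n' \<le> n'' + 1" "(j'' = even n'') = (j = even n)"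
    using form_mult_left[OF i 1(1)] 1(3) by metis
  moreover have "word_prod (x # u) \<otimes> g = x \<otimes> (word_prod u \<otimes> g)"
    using Cons set_carrier[of "x # u"] form_carrier by (simp add: m_assoc)
  ultimately show ?case using 1 by (intro exI[of _ j''] exI[of _ n'']) auto
qed

text \<open>The mirror image: fewer than \<open>n\<close> letters on the right cannot cancel the
  first letter of \<open>g\<close>.\<close>

lemma form_word_mult_right:
  assumes "set u \<subseteq> H True \<union> H False" "form g j n" "length u < n"
  shows "\<exists>n'. form (g \<otimes> word_prod u) j n'"
  using assms
proof (induction u arbitrary: g n)
  case Nil
  then show ?case using form_carrier by auto
next
  case (Cons x u)
  obtain i where i: "x \<in> H i" using Cons by auto
  obtain n' where n': "form (g \<otimes> x) j n'" "n \<le> n' + 1"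
    using form_mult_right[OF i Cons.prems(2)] Cons by auto
  then obtain n'' where "form ((g \<otimes> x) \<otimes> word_prod u) j n''" using Cons.IH[OF _ n'(1)] Cons.prems by auto
  moreover have "g \<otimes> word_prod (x # u) = (g \<otimes> x) \<otimes> word_prod u"
    using Cons set_carrier[of "x # u"] form_carrier by (simp add: m_assoc)
  ultimately show ?case by auto
qed

lemma form_exists:
  assumes "g \<in> carrier G"
  shows "\<exists>i n. form g i n"
proof -
  obtain u where u: "set u \<subseteq> H True \<union> H False" "g = word_prod u" using generated[OF assms] by blast
  have "\<exists>i n. form (word_prod u) i n" using u(1)
  proof (induction u)
    case Nil
    then show ?case using form_0_iff Z_one by auto
  next
    case (Cons x u)
    then obtain i j n where "x \<in> H i" "form (word_prod u) j n" by auto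
    then show ?case using form_mult_left by fastforce
  qed
  then show ?thesis using u by simp
qed

section \<open>Malnormality of the factors modulo the central subgroup\<close>

text \<open>If a \<open>y\<close> of positive length ended outside factor \<open>i\<close>, then
  \<open>y \<otimes> g\<close> would be longer than \<open>y\<close> with the same first factor,
  whereas \<open>h \<otimes> y\<close> can only grow by gaining a first letter from factor
  \<open>i\<close>. A last letter \<open>b\<close> in factor \<open>i\<close> is absorbed by
  conjugating \<open>g\<close>, and the same comparison forces what precedes \<open>b\<close> into
  \<open>Z\<close>.\<close>

lemma factors_malnormal_mod_Z:
  assumes y: "y \<in> carrier G" and g: "g \<in> H i - Z" "h \<in> H i" and eq: "y \<otimes> g = h \<otimes> y"
  shows "y \<in> H i"
proof -
  have no: False if v: "form v j n" "n > 0" "i = (j = even n)" and c: "c \<in> H i - Z"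
    and eq: "v \<otimes> c = h \<otimes> v" for v j n c
  proof -
    have 1: "form (v \<otimes> c) j (n + 1)" using form_mult[OF v(1)] form_1[OF c] v(3) by blast
    obtain j' n' where 2: "form (h \<otimes> v) j' n'" "n' \<le> n + 1" "j = i \<longrightarrow> n' \<le> n"
      using form_mult_left[OF g(2) v(1)] v(2) by blast
    have "j' = j" "n' = n + 1" using form_unique[OF 1 2(1)[folded eq]] by auto
    then have ji: "j = (\<not> i)" using 2(3) by auto
    have hv: "form (h \<otimes> v) j (n + 1)" using 1 eq by simp
    show False
    proof (cases "h \<in> Z")
      case True
      then show False using form_unique[OF hv form_Z_mult[OF True v(1)]] by simp
    next
      case False
      then have "form (h \<otimes> v) i (1 + n)" using form_mult[of h i 1 v n] form_1[of h i] v(1) ji g by auto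
      then show False using form_unique[OF hv] ji by fastforce
    qed
  qed
  obtain j n where f: "form y j n" using form_exists[OF y] by blast
  show ?thesis
  proof (cases "n = 0")
    case True
    then show ?thesis using f form_0_iff Z_subset by blast
  next
    case False
    then obtain m where m: "n = m + 1" by (cases n) auto
    have "i \<noteq> (j = even n)" using no[OF f _ _ g(1) eq] False by blast
    then have im: "i = (j = even m)" using m by auto
    obtain v b where vb: "form v j m" "form b i 1" "y = v \<otimes> b"
      using form_split[of y j m 1] f m im by auto
    have b: "b \<in> H i - Z" by (rule form_1D[OF vb(2)])
    have car: "v \<in> carrier G" "b \<in> carrier G" "g \<in> carrier G" "h \<in> carrier G"
      using vb form_carrier H_carrier g by blast+
    show ?thesis
    proof (cases "m = 0")
      case True
      then have "v \<in> H i" using vb form_0_iff Z_subset by blast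
      then show ?thesis using vb b H_mult by blast
    next
      case False
      \<comment> \<open>Were this conjugate central, it would equal \<open>g\<close>, which is not
        in \<open>Z\<close>.\<close>
      have "b \<otimes> g \<otimes> inv b \<notin> Z"
      proof
        assume "b \<otimes> g \<otimes> inv b \<in> Z"
        then have "b \<otimes> (b \<otimes> g \<otimes> inv b) = (b \<otimes> g \<otimes> inv b) \<otimes> b"
          using Z_commute car by simp
        then have "b \<otimes> (b \<otimes> g \<otimes> inv b) = b \<otimes> g" using car by (simp add: m_assoc)
        then have "b \<otimes> g \<otimes> inv b = g" using car by simp
        then show False using \<open>b \<otimes> g \<otimes> inv b \<in> Z\<close> g by simp
      qed
      then have "b \<otimes> g \<otimes> inv b \<in> H i - Z" using b g H_mult H_inv by blast
      moreover have "v \<otimes> (b \<otimes> g \<otimes> inv b) = h \<otimes> v"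
        using eq car vb by (metis inv_closed inv_solve_right m_assoc m_closed)
      ultimately show ?thesis using no[OF vb(1) _ im] False by blast
    qed
  qed
qed

lemma commute_in_factor:
  assumes "y \<in> carrier G" "g \<in> H i - Z" "y \<otimes> g = g \<otimes> y"
  shows "y \<in> H i"
  using factors_malnormal_mod_Z assms by blast

section \<open>Elements not conjugate into a factor\<close>

text \<open>In terms of the Bass-Serre tree, these are the elements that fix no vertex.\<close>

definition hyperbolic :: "'a \<Rightarrow> bool" where
  "hyperbolic g \<longleftrightarrow> g \<in> carrier G \<and> (\<forall>c\<in>carrier G. \<forall>i. conjugate c g \<notin> H i)"

text \<open>A form of odd length at least 3 begins and ends in the same factor; conjugating by its
  last letter merges the two ends and shortens it. A form of positive even length cannot be
  shortened this way and is kept.\<close>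

lemma cyclically_reduced:
  assumes "form g i n"
  shows "\<exists>c\<in>carrier G. (\<exists>j. conjugate c g \<in> H j) \<or> (\<exists>j m. m > 0 \<and> even m \<and> form (conjugate c g) j m)"
  using assms
proof (induction n arbitrary: g i rule: less_induct)
  case (less n)
  have g: "g \<in> carrier G" "conjugate \<one> g = g" using form_carrier less by (auto simp: conjugate_def)
  consider "n = 0" | "n = 1" | "n > 0" "even n" | "n \<ge> 3" "odd n"
  proof -
    have "n = 0 \<or> n = 1 \<or> (n > 0 \<and> even n) \<or> (n \<ge> 3 \<and> odd n)" by presburger
    then show ?thesis using that by blast
  qed
  then show ?case
  proof cases
    case 1
    then show ?thesis using less form_0_iff Z_subset g by (metis one_closed subsetD)
  next
    case 2
    then show ?thesis using less form_1D g by (metis DiffD1 one_closed)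
  next
    case 3
    then show ?thesis using less g by (metis one_closed)
  next
    case 4
    \<comment> \<open>The length of the middle part \<open>w\<close> of
      \<open>a \<otimes> w \<otimes> b\<close>, with single letters \<open>a\<close> and
      \<open>b\<close>.\<close>
    define m where "m = n - 2"
    then have m: "n = (1 + m) + 1" "m > 0" using 4 by auto
    obtain h b where hb: "form h i (1 + m)" "form b i 1" "g = h \<otimes> b"
      using form_split[of g i "1 + m" 1] less.prems m(1) 4(2) by auto
    obtain a w where aw: "form a i 1" "form w (\<not> i) m" "h = a \<otimes> w"
      using form_split[of h i 1 m] hb by auto
    have car: "a \<in> carrier G" "w \<in> carrier G" "b \<in> carrier G"
      using hb aw form_carrier by blast+
    have ba: "b \<otimes> a \<in> H i" using form_1D aw hb H_mult by blast
    have eq: "conjugate b g = (b \<otimes> a) \<otimes> w"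
      using car by (simp add: conjugate_def hb aw m_assoc)
    obtain j' n' where f: "form (conjugate b g) j' n'" "n' \<le> m + 1"
      using form_mult_left[OF ba aw(2)] eq by auto
    then obtain c where c: "c \<in> carrier G"
      "(\<exists>j. conjugate c (conjugate b g) \<in> H j) \<or> (\<exists>j m. m > 0 \<and> even m \<and> form (conjugate c (conjugate b g)) j m)"
      using less.IH[of n', OF _ f(1)] m by auto
    then show ?thesis using conjugate_conjugate car g by (metis m_closed)
  qed
qed

text \<open>The choice depends only on the coset, so letters equal modulo \<open>Z\<close> become
  equal list entries and commutation can be studied on plain words.\<close>

definition rep :: "'a \<Rightarrow> 'a" where "rep x = (SOME y. y \<in> Z #> x)"

lemma rep_in:
  assumes "x \<in> H i - Z"
  shows "rep x \<in> H i - Z" "\<exists>z\<in>Z. x = z \<otimes> rep x"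
proof -
  have x: "x \<in> carrier G" using assms H_carrier by blast
  have "rep x \<in> Z #> x" unfolding rep_def using rcos_self[OF x Z_subgroup] by (rule someI)
  then obtain z where z: "z \<in> Z" "rep x = z \<otimes> x" by (auto simp: r_coset_def)
  then show "rep x \<in> H i - Z" using assms x Z_mult_left_iff H_mult Z_subset by (metis Diff_iff subsetD)
  show "\<exists>z\<in>Z. x = z \<otimes> rep x"
    using z x Z_inv[of z] Z_carrier[of z] by (intro bexI[of _ "inv z"]) (auto simp: inv_solve_left)
qed

text \<open>Each replacement of a letter by its representative costs an element of \<open>Z\<close>,
  and these gather in front.\<close>

lemma rep_word:
  assumes "alternating (\<lambda>i. H i - Z) i u"
  shows "alternating (\<lambda>i. H i - Z) i (map rep u) \<and> (\<exists>z\<in>Z. word_prod u = z \<otimes> word_prod (map rep u))"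
  using assms
proof (induction u arbitrary: i)
  case Nil
  then show ?case using Z_one Z_carrier by force
next
  case (Cons x u)
  then obtain z where z: "z \<in> Z" "word_prod u = z \<otimes> word_prod (map rep u)"
    and a: "alternating (\<lambda>i. H i - Z) (\<not> i) (map rep u)" by auto
  obtain y where y: "y \<in> Z" "x = y \<otimes> rep x" using rep_in Cons by (metis alternating.simps(2))
  have r: "rep x \<in> H i - Z" using Cons rep_in by auto
  have car: "z \<in> carrier G" "y \<in> carrier G" "rep x \<in> carrier G" "word_prod (map rep u) \<in> carrier G"
    using Z_carrier z y r H_carrier alternating_carrier[OF a] by auto
  have "x \<otimes> word_prod u = (y \<otimes> rep x) \<otimes> (z \<otimes> word_prod (map rep u))" using y z by simp
  also have "\<dots> = (y \<otimes> z) \<otimes> (rep x \<otimes> word_prod (map rep u))"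
    using Z_commute[OF z(1) car(3)] car by (metis m_assoc m_closed)
  finally show ?case using a r Z_mult[OF y(1) z(1)] by auto
qed

lemma Z_mult_swap:
  assumes "z \<in> Z" "y \<in> Z" "a \<in> carrier G" "b \<in> carrier G"
  shows "(z \<otimes> a) \<otimes> (y \<otimes> b) = (z \<otimes> y) \<otimes> (a \<otimes> b)"
proof -
  have car: "z \<in> carrier G" "y \<in> carrier G" using assms Z_carrier by auto
  have "(z \<otimes> a) \<otimes> (y \<otimes> b) = z \<otimes> ((a \<otimes> y) \<otimes> b)" using car assms by (simp add: m_assoc)
  also have "a \<otimes> y = y \<otimes> a" using Z_commute assms by simp
  finally show ?thesis using car assms by (simp add: m_assoc)
qed

lemma Z_commute_iff:
  assumes "z \<in> Z" "y \<in> Z" "a \<in> carrier G" "b \<in> carrier G"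
  shows "(z \<otimes> a) \<otimes> (y \<otimes> b) = (y \<otimes> b) \<otimes> (z \<otimes> a) \<longleftrightarrow> a \<otimes> b = b \<otimes> a"
  using Z_mult_swap[OF assms] Z_mult_swap[OF assms(2,1,4,3)] Z_commute[of y z] Z_carrier assms by simp

text \<open>For even forms starting in the same factor, products in either order are concatenations
  without cancellation. Uniqueness of letters turns commutation with \<open>g\<close> into
  commutation of words of representatives, where it is transitive because the word of
  \<open>g\<close> is nonempty.\<close>

lemma even_commute_trans:
  assumes g: "form g i n" "n > 0" "even n" and h: "form h i m" "even m" "h \<otimes> g = g \<otimes> h"
    and k: "form k i l" "even l" "k \<otimes> g = g \<otimes> k"
  shows "h \<otimes> k = k \<otimes> h"
proof -
  let ?alt = "alternating (\<lambda>i. H i - Z) i"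
  obtain z w where w: "z \<in> Z" "?alt w" "length w = n" "g = z \<otimes> word_prod w"
    using g unfolding form_def by blast
  obtain z1 u where u: "z1 \<in> Z" "?alt u" "length u = m" "h = z1 \<otimes> word_prod u"
    using h unfolding form_def by blast
  obtain z2 v where v: "z2 \<in> Z" "?alt v" "length v = l" "k = z2 \<otimes> word_prod v"
    using k unfolding form_def by blast
  note wc = alternating_carrier[OF w(2)]
  have word: "map rep u @ map rep w = map rep w @ map rep u"
    if u: "z1 \<in> Z" "?alt u" "even (length u)" and "(z1 \<otimes> word_prod u) \<otimes> g = g \<otimes> (z1 \<otimes> word_prod u)"
    for z1 u
  proof -
    note uc = alternating_carrier[OF u(2)]
    have "word_prod u \<otimes> word_prod w = word_prod w \<otimes> word_prod u"
      using that wc uc Z_commute_iff[OF u(1) w(1)] w by simp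
    then have "word_prod (u @ w) = \<one> \<otimes> word_prod (w @ u)" using uc wc by (simp add: word_prod_append)
    moreover have "?alt (u @ w)" "?alt (w @ u)" using u w g by (simp_all add: alternating_append)
    ultimately have "map (r_coset G Z) (u @ w) = map (r_coset G Z) (w @ u)"
      using letters_unique Z_one by blast
    \<comment> \<open>Choosing a member of each coset turns the list of cosets into the list of
      representatives.\<close>
    then have "map (\<lambda>C. SOME y. y \<in> C) (map (r_coset G Z) (u @ w))
        = map (\<lambda>C. SOME y. y \<in> C) (map (r_coset G Z) (w @ u))" by simp
    then show ?thesis unfolding rep_def[abs_def] by (simp add: comp_def)
  qed
  have "map rep u @ map rep v = map rep v @ map rep u"
  proof (rule append_commute_trans)
    show "map rep u @ map rep w = map rep w @ map rep u" using word[OF u(1,2)] u h by simp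
    show "map rep v @ map rep w = map rep w @ map rep v" using word[OF v(1,2)] v k by simp
    show "map rep w \<noteq> []" using w g by auto
  qed
  moreover obtain y1 y2 where y: "y1 \<in> Z" "word_prod u = y1 \<otimes> word_prod (map rep u)"
    "y2 \<in> Z" "word_prod v = y2 \<otimes> word_prod (map rep v)"
    using rep_word[OF u(2)] rep_word[OF v(2)] by blast
  moreover have c: "set (map rep u) \<subseteq> carrier G" "set (map rep v) \<subseteq> carrier G"
    using rep_word[OF u(2)] rep_word[OF v(2)] alternating_carrier by blast+
  ultimately have "word_prod (map rep u) \<otimes> word_prod (map rep v) = word_prod (map rep v) \<otimes> word_prod (map rep u)"
    by (metis word_prod_append)
  then have "word_prod u \<otimes> word_prod v = word_prod v \<otimes> word_prod u" using y c Z_commute_iff[OF y(1,3)] by simp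
  then show ?thesis
    using Z_commute_iff[OF u(1) v(1)] alternating_carrier[OF u(2)] alternating_carrier[OF v(2)] u v by simp
qed

lemma form_pow:
  assumes "form g i n" "even n"
  shows "form (g [^] (k::nat)) i (n * k)"
proof (induction k)
  case 0
  then show ?case using Z_one by (simp add: form_0_iff)
next
  case (Suc k)
  then show ?case using form_mult[OF Suc, of g n] assms by (simp add: add.commute)
qed

text \<open>A high power of \<^term>\<open>g\<close> absorbs all cancellation, so that \<^term>\<open>x \<otimes> g [^] k = g [^] k \<otimes> x\<close>
  begins like \<^term>\<open>g\<close> and ends like \<^term>\<open>g\<close>.\<close>

lemma commute_even_form:
  assumes g: "form g i n" "n > 0" "even n" and x: "x \<in> carrier G" "x \<otimes> g = g \<otimes> x"
  shows "\<exists>(k::nat) m. form (x \<otimes> g [^] k) i m \<and> even m"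
proof -
  obtain u where u: "set u \<subseteq> H True \<union> H False" "x = word_prod u" using generated[OF x(1)] by blast
  \<comment> \<open>Any \<open>k\<close> with \<open>n * k > length u\<close> would do.\<close>
  define k where "k = length u + 1"
  have f: "form (g [^] k) i (n * k)" using form_pow g by blast
  have l: "length u < n * k" using g(2) unfolding k_def by (cases n) auto
  obtain j' n' where 1: "form (x \<otimes> g [^] k) j' n'" "n * k \<le> n' + length u"
    "(j' = even n') = (i = even (n * k))"
    using form_word_mult_left[OF u(1) f l] u(2) by blast
  obtain n'' where 2: "form (g [^] k \<otimes> x) i n''"
    using form_word_mult_right[OF u(1) f l] u(2) by blast
  have "g [^] k \<otimes> x = x \<otimes> g [^] k"
    using commute_pow[of g x k] x form_carrier[OF g(1)] by simp
  \<comment> \<open>Multiplication from the left keeps the last factor of the power, multiplication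
    from the right its first factor. Both give the same element, which therefore starts in
    \<open>i\<close>, ends in the opposite factor and has even length.\<close>
  then have "n'' = n'" "j' = i" using form_unique[OF 1(1), of i n''] 2 1(2) l by auto
  then have "even n'" using 1(3) g(3) by auto
  then show ?thesis using 1(1) \<open>j' = i\<close> by blast
qed

text \<open>Powers of \<open>g\<close> turn \<open>x\<close> and \<open>y\<close> into even forms
  that start in the factor of \<open>g\<close>, and these commute; the powers commute with
  everything involved and are cancelled again.\<close>

lemma even_centraliser_abelian:
  assumes g: "form g i n" "n > 0" "even n"
    and x: "x \<in> carrier G" "x \<otimes> g = g \<otimes> x" and y: "y \<in> carrier G" "y \<otimes> g = g \<otimes> y"
  shows "x \<otimes> y = y \<otimes> x"
proof -
  obtain k m where k: "form (x \<otimes> g [^] (k::nat)) i m" "even m" using commute_even_form[OF g x] by blast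
  obtain l m' where l: "form (y \<otimes> g [^] (l::nat)) i m'" "even m'" using commute_even_form[OF g y] by blast
  have gc: "g \<in> carrier G" by (rule form_carrier[OF g(1)])
  have pow: "g [^] j \<otimes> g = g \<otimes> g [^] j" for j :: nat using commute_pow[of g g] gc by simp
  have cg: "(x \<otimes> g [^] k) \<otimes> g = g \<otimes> (x \<otimes> g [^] k)" "(y \<otimes> g [^] l) \<otimes> g = g \<otimes> (y \<otimes> g [^] l)"
    using commute_mult[OF _ _ gc _ pow] x y gc by simp_all
  have "(x \<otimes> g [^] k) \<otimes> (y \<otimes> g [^] l) = (y \<otimes> g [^] l) \<otimes> (x \<otimes> g [^] k)"
    by (rule even_commute_trans[OF g k cg(1) l cg(2)])
  then have "x \<otimes> (y \<otimes> g [^] l) = (y \<otimes> g [^] l) \<otimes> x"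
    using commute_cancel_right[of x "g [^] k" "y \<otimes> g [^] l"] commute_pow[of g "y \<otimes> g [^] l" k]
      cg(2) x y gc by simp
  then show ?thesis
    using commute_cancel_right[of y "g [^] l" x] commute_pow[of g x l] x y gc by simp
qed

text \<open>Cyclic reduction of such a \<open>g\<close> can only end in a form of positive even
  length, and commutation is invariant under conjugation.\<close>

lemma hyperbolic_centraliser_abelian:
  assumes g: "hyperbolic g"
    and x: "x \<in> carrier G" "x \<otimes> g = g \<otimes> x" and y: "y \<in> carrier G" "y \<otimes> g = g \<otimes> y"
  shows "x \<otimes> y = y \<otimes> x"
proof -
  have gc: "g \<in> carrier G" using g hyperbolic_def by blast
  obtain i n where "form g i n" using form_exists[OF gc] by blast
  from cyclically_reduced[OF this] obtain c j m
    where c: "c \<in> carrier G" "m > 0" "even m" "form (conjugate c g) j m"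
    using g unfolding hyperbolic_def by blast
  have "conjugate c x \<otimes> conjugate c y = conjugate c y \<otimes> conjugate c x"
    using even_centraliser_abelian[OF c(4,2,3)] x y gc c(1) by (simp flip: conjugate_mult)
  then show ?thesis using x y c(1) by (simp add: conjugate_inj flip: conjugate_mult)
qed

section \<open>Ladders in a central amalgam\<close>

lemma noncentral_imp_letter:
  assumes "g \<in> carrier G" "g \<notin> Z"
  shows "\<exists>i. H i - Z \<noteq> {}"
proof -
  obtain i n where f: "form g i n" using form_exists[OF assms(1)] by blast
  then obtain m where "n = 1 + m" using assms(2) form_0_iff by (cases n) auto
  then obtain h where "form h i 1" using form_split[of g i 1 m] f by blast
  then show ?thesis using form_1D by blast
qed

lemma ladder_factor:
  assumes L: "ladder G {..<k} x y" and k: "k \<ge> 3"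
  shows "\<exists>i. (\<exists>x y. ladder (G\<lparr>carrier := H i\<rparr>) {1..<k - 1} x y) \<and>
    (centre (G\<lparr>carrier := H i\<rparr>) \<subseteq> Z \<longrightarrow> (\<exists>x y. ladder (G\<lparr>carrier := H i\<rparr>) {..<k} x y))"
proof -
  have car: "x i \<in> carrier G" "y i \<in> carrier G" "y i \<otimes> x i \<noteq> x i \<otimes> y i" if "i < k" for i
    using L that unfolding ladder_def by auto
  have com: "y i \<otimes> x j = x j \<otimes> y i" if "j < i" "i < k" for i j
    using L that unfolding ladder_def by auto
  have "\<not> hyperbolic (x 0)"
  proof
    assume h0: "hyperbolic (x 0)"
    \<comment> \<open>\<open>y 2\<close> fails to commute with \<open>x 2\<close>, so none of its
      conjugates is in \<open>Z\<close>; were one in a factor, \<open>x 0\<close>, which commutes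
      with \<open>y 2\<close>, would be conjugate into that factor too.\<close>
    have h2: "hyperbolic (y 2)" unfolding hyperbolic_def
    proof (intro conjI ballI allI notI)
      show "y 2 \<in> carrier G" using car k by simp
      fix c i assume c: "c \<in> carrier G" and i: "conjugate c (y 2) \<in> H i"
      have "conjugate c (y 2) \<otimes> conjugate c (x 2) \<noteq> conjugate c (x 2) \<otimes> conjugate c (y 2)"
        using car[of 2] c k by (simp add: conjugate_inj flip: conjugate_mult)
      then have "conjugate c (y 2) \<in> H i - Z" using i Z_commute car[of 2] c k by auto
      moreover have "conjugate c (x 0) \<otimes> conjugate c (y 2) = conjugate c (y 2) \<otimes> conjugate c (x 0)"
        using com[of 0 2] car(1)[of 0] car(2)[of 2] c k by (simp flip: conjugate_mult)
      ultimately have "conjugate c (x 0) \<in> H i" using commute_in_factor[of "conjugate c (x 0)" "conjugate c (y 2)" i]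
          car(1)[of 0] c k by simp
      then show False using h0 c unfolding hyperbolic_def by blast
    qed
    \<comment> \<open>\<open>x 0\<close> and \<open>x 1\<close> lie in the abelian centraliser of
      \<open>y 2\<close>; afterwards \<open>x 1\<close> and \<open>y 1\<close> lie in that of
      \<open>x 0\<close>.\<close>
    have "x 0 \<otimes> x 1 = x 1 \<otimes> x 0"
      using hyperbolic_centraliser_abelian[OF h2, of "x 0" "x 1"] com[of 0 2] com[of 1 2]
        car[of 0] car[of 1] k by simp
    then have "x 1 \<otimes> y 1 = y 1 \<otimes> x 1"
      using hyperbolic_centraliser_abelian[OF h0, of "x 1" "y 1"] com[of 0 1] car[of 1] k by simp
    then show False using car(3)[of 1] k by simp
  qed
  then obtain c i where c: "c \<in> carrier G" "conjugate c (x 0) \<in> H i"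
    using car[of 0] k unfolding hyperbolic_def by auto
  define x' y' where "x' = conjugate c \<circ> x" and "y' = conjugate c \<circ> y"
  have L': "ladder G {..<k} x' y'" unfolding x'_def y'_def by (rule ladder_conjugate[OF c(1) L])
  have car: "x' i \<in> carrier G" "y' i \<in> carrier G" "y' i \<otimes> x' i \<noteq> x' i \<otimes> y' i" if "i < k" for i
    using L' that unfolding ladder_def by auto
  have com: "y' i \<otimes> x' j = x' j \<otimes> y' i" if "j < i" "i < k" for i j
    using L' that unfolding ladder_def by auto
  have X0: "x' 0 \<in> H i - Z" using c car[of 0] k Z_commute[of "x' 0" "y' 0"] by (auto simp: x'_def)
  have inH_y: "y' j \<in> H i" if "0 < j" "j < k" for j
    using commute_in_factor[OF car(2) X0] com that by blast
  \<comment> \<open>This element commutes with every earlier \<open>x' j\<close> and, being outside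
    \<open>Z\<close>, pulls them all into the factor.\<close>
  have Yk: "y' (k - 1) \<in> H i - Z"
    using inH_y[of "k - 1"] car[of "k - 1"] k Z_commute[of "y' (k - 1)" "x' (k - 1)"] by auto
  have inH_x: "x' j \<in> H i" if "j < k - 1" for j
    using commute_in_factor[OF car(1) Yk, of j] com[of j "k - 1"] that by auto
  have 1: "ladder (G\<lparr>carrier := H i\<rparr>) {1..<k - 1} x' y'"
    unfolding ladder_def using inH_x inH_y car com by auto
  have "\<exists>x y. ladder (G\<lparr>carrier := H i\<rparr>) {..<k} x y" if cZ: "centre (G\<lparr>carrier := H i\<rparr>) \<subseteq> Z"
  proof -
    have nc: "\<exists>b\<in>H i. b \<otimes> a \<noteq> a \<otimes> b" if "a \<in> H i - Z" for a
      using that cZ unfolding centre_def centraliser_def by fastforce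
    obtain a b where ab: "b \<in> H i" "b \<otimes> x' 0 \<noteq> x' 0 \<otimes> b" "a \<in> H i" "a \<otimes> y' (k - 1) \<noteq> y' (k - 1) \<otimes> a"
      using nc[OF X0] nc[OF Yk] by blast
    \<comment> \<open>\<open>y' 0\<close> has no earlier rung to commute with and
      \<open>x' (k - 1)\<close> no later one, so each may be replaced by any element that fails to
      commute with its partner.\<close>
    have "ladder (G\<lparr>carrier := H i\<rparr>) {..<k} (x'(k - 1 := a)) (y'(0 := b))"
      unfolding ladder_def using inH_x inH_y car com ab k by (auto dest: sym)
    then show ?thesis by blast
  qed
  with 1 show ?thesis by blast
qed

abbreviation factor :: "bool \<Rightarrow> ('a, 'b) monoid_scheme" where "factor i \<equiv> G\<lparr>carrier := H i\<rparr>"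

lemma cdim_factor_le: "cdim (factor i) \<le> cdim G"
  using cdim_mono_subgroup[OF is_group H_subgroup] .

lemma enat_le_cdim_factor:
  assumes "enat k \<le> cdim G" "k \<ge> 3"
  shows "\<exists>i. enat (k - 2) \<le> cdim (factor i) \<and> (centre (factor i) \<subseteq> Z \<longrightarrow> enat k \<le> cdim (factor i))"
proof -
  obtain x y where "ladder G {..<k} x y" using assms(1) enat_le_cdim_iff by blast
  from ladder_factor[OF this assms(2)] obtain i x' y' where
    *: "ladder (factor i) {1..<k - 1} x' y'"
       "centre (factor i) \<subseteq> Z \<Longrightarrow> \<exists>x y. ladder (factor i) {..<k} x y" by blast
  have "enat (k - 2) \<le> cdim (factor i)"
    using enat_le_cdimI[OF *(1)] by (simp add: numeral_2_eq_2)
  then show ?thesis using *(2) enat_le_cdim_iff by blast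
qed

theorem cdim_amalgam_centres:
  assumes centre: "\<And>i. centre (factor i) = Z" and nonabelian: "\<And>i. H i \<noteq> Z"
  shows "cdim G = max (cdim (factor True)) (cdim (factor False))"
proof (rule antisym)
  show "max (cdim (factor True)) (cdim (factor False)) \<le> cdim G" using cdim_factor_le by simp
  show "cdim G \<le> max (cdim (factor True)) (cdim (factor False))"
  proof (rule enat_le_imp_le)
    fix k assume k: "enat k \<le> cdim G"
    have "\<exists>i. enat k \<le> cdim (factor i)"
    proof (cases "k \<ge> 3")
      case True
      then show ?thesis using enat_le_cdim_factor[OF k] centre by auto
    next
      case False
      \<comment> \<open>Lengths below 3 need only a noncentral element of one factor.\<close>
      obtain x where "x \<in> H True - Z" using nonabelian[of True] Z_subset by blast
      then have "2 \<le> cdim (factor True)" using two_le_cdim_noncentral[of x "factor True"] centre by auto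
      moreover have "enat k \<le> 2" using False by (simp add: numeral_eq_enat)
      ultimately show ?thesis by (meson order_trans)
    qed
    then obtain i where "enat k \<le> cdim (factor i)" by blast
    then show "enat k \<le> max (cdim (factor True)) (cdim (factor False))" by (cases i) (auto simp: le_max_iff_disj)
  qed
qed

text \<open>If \<open>t\<close> commuted with \<open>c\<close>, it would lie in \<open>H i\<close>;
  so the two do not commute, while \<open>c\<close> commutes with every element of a ladder in its
  own factor.\<close>

lemma ladder_extend:
  assumes c: "c \<in> centre (factor i)" "c \<notin> Z" and t: "t \<in> H (\<not> i)" "t \<notin> Z"
    and L: "ladder (factor i) {..<n} x y"
  shows "\<exists>x y. ladder G {..<n + 2} x y"
proof -
  have cH: "c \<in> H i" "\<And>h. h \<in> H i \<Longrightarrow> c \<otimes> h = h \<otimes> c"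
    using c unfolding centre_def centraliser_def by auto
  have ct: "t \<otimes> c \<noteq> c \<otimes> t"
    using commute_in_factor[of t c i] HD_disjoint[of t "\<not> i"] H_carrier c cH t by auto
  \<comment> \<open>One rung \<open>(c, t)\<close> goes before the ladder and one rung
    \<open>(t, c)\<close> after it; the first and the last rung are compatible because
    \<open>c\<close> commutes with itself.\<close>
  let ?x = "\<lambda>j. if j = 0 then c else if j = n + 1 then t else x (j - 1)"
  let ?y = "\<lambda>j. if j = 0 then t else if j = n + 1 then c else y (j - 1)"
  have L1: "x j \<in> H i" "y j \<in> H i" "y j \<otimes> x j \<noteq> x j \<otimes> y j" if "j < n" for j
    using L that unfolding ladder_def by auto
  have L2: "y j \<otimes> x l = x l \<otimes> y j" if "j < n" "l < j" for j l
    using L that unfolding ladder_def by auto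
  have "ladder G {..<n + 2} ?x ?y"
    unfolding ladder_def
  proof (intro conjI ballI impI)
    fix j assume j: "j \<in> {..<n + 2}"
    then consider "j = 0" | "j = n + 1" | "j \<noteq> 0" "j \<noteq> n + 1" "j - 1 < n" by fastforce
    note j_cases = this
    show "?x j \<in> carrier G" "?y j \<in> carrier G"
      by (cases rule: j_cases; use L1[of "j - 1"] H_carrier cH t in auto)+
    show "?y j \<otimes> ?x j \<noteq> ?x j \<otimes> ?y j"
      by (cases rule: j_cases) (use L1[of "j - 1"] ct in auto)
    fix l assume l: "l \<in> {..<n + 2}" "l < j"
    show "?y j \<otimes> ?x l = ?x l \<otimes> ?y j"
    proof (cases "l = 0")
      case True
      then show ?thesis using l cH(2)[OF L1(2)[of "j - 1"]] j by (auto split: if_splits)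
    next
      case False
      then have "l - 1 < n" "l \<noteq> n + 1" using l j by auto
      moreover have "j \<noteq> n + 1 \<Longrightarrow> j - 1 < n \<and> l - 1 < j - 1" using False l j by auto
      ultimately show ?thesis
        using False l cH(2)[OF L1(1)[of "l - 1"]] L2[of "j - 1" "l - 1"] by auto
    qed
  qed
  then show ?thesis by blast
qed

text \<open>Whenever a factor has nontrivial centre, \<open>proper\<close> supplies an element
  outside \<open>Z\<close> in the opposite factor; the lower bound uses it to lengthen ladders by
  2.\<close>

theorem cdim_free_amalgam:
  assumes Z: "Z = {\<one>}" and proper: "\<And>i. H i = {\<one>} \<Longrightarrow> centre (factor (\<not> i)) = {\<one>}"
  shows "cdim G = max (cdim (factor True) + zz (factor True)) (cdim (factor False) + zz (factor False))"
    (is "_ = ?m")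
proof (rule antisym)
  have le_m: "enat k \<le> ?m" if "enat k \<le> cdim (factor i) + zz (factor i)" for k i
    using that by (cases i) (auto simp: le_max_iff_disj)
  show "cdim G \<le> ?m"
  proof (rule enat_le_imp_le)
    fix k assume k: "enat k \<le> cdim G"
    consider "k = 0" | "0 < k" "k < 3" | "k \<ge> 3" by linarith
    then show "enat k \<le> ?m"
    proof cases
      case 1
      then show ?thesis by (simp flip: zero_enat_def)
    next
      case 2
      obtain x y where "ladder G {..<k} x y" using k enat_le_cdim_iff by blast
      then have "x 0 \<in> carrier G" "y 0 \<in> carrier G" "y 0 \<otimes> x 0 \<noteq> x 0 \<otimes> y 0"
        using 2 unfolding ladder_def by auto
      then have "x 0 \<in> carrier G" "x 0 \<notin> Z" using Z_commute[of "x 0" "y 0"] by auto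
      then obtain i g where g: "g \<in> H i" "g \<notin> Z" using noncentral_imp_letter by blast
      \<comment> \<open>A nontrivial factor contributes at least 2: by a noncommuting pair if its
        centre is trivial, by \<open>zz\<close> otherwise.\<close>
      have "2 \<le> cdim (factor i) + zz (factor i)"
      proof (cases "centre (factor i) = {\<one>}")
        case True
        then have "2 \<le> cdim (factor i)" using g Z two_le_cdim_noncentral[of g "factor i"] by simp
        then show ?thesis using True by (simp add: zz_def)
      next
        case False
        then show ?thesis by (simp add: zz_def)
      qed
      moreover have "enat k \<le> 2" using 2 by (simp add: numeral_eq_enat)
      ultimately show ?thesis using le_m order_trans by blast
    next
      case 3
      then obtain i where i: "enat (k - 2) \<le> cdim (factor i)"
        "centre (factor i) \<subseteq> Z \<Longrightarrow> enat k \<le> cdim (factor i)"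
        using enat_le_cdim_factor[OF k] by blast
      have "enat k \<le> cdim (factor i) + zz (factor i)"
      proof (cases "centre (factor i) = {\<one>}")
        case True
        then show ?thesis using i(2) Z by (simp add: zz_def)
      next
        case False
        have "enat (k - 2) + 2 \<le> cdim (factor i) + 2" using i(1) by (rule add_right_mono)
        moreover have "enat (k - 2) + 2 = enat k" using 3 by (simp add: numeral_eq_enat)
        ultimately show ?thesis using False by (simp add: zz_def)
      qed
      then show ?thesis by (rule le_m)
    qed
  qed
  have "cdim (factor i) + zz (factor i) \<le> cdim G" for i
  proof (cases "centre (factor i) = {\<one>}")
    case True
    then show ?thesis using cdim_factor_le by (simp add: zz_def)
  next
    case False
    have "\<one> \<in> centre (factor i)" using Z_one Z_subset[of i] H_carrier
      by (auto simp: centre_def centraliser_def)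
    then obtain c where c: "c \<in> centre (factor i)" "c \<notin> Z" using False Z by blast
    have "H (\<not> i) \<noteq> {\<one>}" using proper[of "\<not> i"] False by auto
    then obtain t where t: "t \<in> H (\<not> i)" "t \<notin> Z" using Z Z_subset by blast
    have z: "zz (factor i) = 2" using False by (simp add: zz_def)
    show ?thesis
    proof (rule enat_le_imp_le)
      fix k assume k: "enat k \<le> cdim (factor i) + zz (factor i)"
      show "enat k \<le> cdim G"
      proof (cases "k < 2")
        case True
        \<comment> \<open>The truncated difference \<open>k - 2\<close> is of no use here; extending
          the empty ladder gives length 2.\<close>
        have "\<exists>x y. ladder G {..<0 + 2} x y"
          by (rule ladder_extend[OF c t]) (simp add: ladder_def)
        then have "enat 2 \<le> cdim G" unfolding add_0 enat_le_cdim_iff .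
        then show ?thesis using True by (meson enat_ord_simps(1) less_imp_le order_trans)
      next
        case False
        then have "enat (k - 2) \<le> cdim (factor i)"
          using k z by (cases "cdim (factor i)") (auto simp: numeral_eq_enat)
        then obtain x y where "ladder (factor i) {..<k - 2} x y" using enat_le_cdim_iff by blast
        from ladder_extend[OF c t this] have "enat (k - 2 + 2) \<le> cdim G"
          unfolding enat_le_cdim_iff .
        moreover have "k - 2 + 2 = k" using False by simp
        ultimately show ?thesis by simp
      qed
    qed
  qed
  then show "?m \<le> cdim G" by simp
qed

end

section \<open>Products amalgamating central subgroups\<close>

text \<open>Members of \<open>N\<close> get the unit as representative, so that a letter disappears
  from a reduced word exactly when its representative is the unit.\<close>

definition coset_rep :: "('a, 'm) monoid_scheme \<Rightarrow> 'a set \<Rightarrow> 'a \<Rightarrow> 'a" where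
  "coset_rep G N x = (if x \<in> N then \<one>\<^bsub>G\<^esub> else SOME y. y \<in> N #>\<^bsub>G\<^esub> x)"

lemma (in group) coset_rep_decomp:
  assumes N: "subgroup N G" and x: "x \<in> carrier G"
  shows "coset_rep G N x \<in> carrier G" "\<exists>n\<in>N. x = n \<otimes> coset_rep G N x"
proof -
  have 1: "coset_rep G N x \<in> carrier G \<and> (\<exists>n\<in>N. x = n \<otimes> coset_rep G N x)"
  proof (cases "x \<in> N")
    case True
    then show ?thesis using x by (auto simp: coset_rep_def intro!: bexI[of _ x])
  next
    case False
    then have "coset_rep G N x \<in> N #> x"
      using someI[of "\<lambda>y. y \<in> N #> x", OF rcos_self[OF x N]] by (simp add: coset_rep_def)
    then obtain n where n: "n \<in> N" "coset_rep G N x = n \<otimes> x" by (auto simp: r_coset_def)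
    then have "n \<in> carrier G" using N subgroup.mem_carrier by metis
    then show ?thesis using n x subgroup.m_inv_closed[OF N n(1)] by (intro conjI bexI[of _ "inv n"]) auto
  qed
  then show "coset_rep G N x \<in> carrier G" "\<exists>n\<in>N. x = n \<otimes> coset_rep G N x" by auto
qed

lemma (in group) coset_rep_mult:
  assumes N: "subgroup N G" and x: "x \<in> carrier G" and n: "n \<in> N"
  shows "coset_rep G N (n \<otimes> x) = coset_rep G N x"
proof -
  have nc: "n \<in> carrier G" using N n subgroup.mem_carrier by metis
  have "N #> (n \<otimes> x) = N #> x"
    using coset_mult_assoc[of N n x] coset_join2[OF nc N n] N nc x subgroup.subset by metis
  moreover have "n \<otimes> x \<in> N \<longleftrightarrow> x \<in> N"
  proof
    assume "n \<otimes> x \<in> N"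
    then have "inv n \<otimes> (n \<otimes> x) \<in> N" using N n subgroup.m_closed subgroup.m_inv_closed by metis
    then show "x \<in> N" using nc x by simp
  qed (use N n subgroup.m_closed in metis)
  ultimately show ?thesis by (simp add: coset_rep_def)
qed

lemma (in group) coset_rep_one [simp]: "subgroup N G \<Longrightarrow> coset_rep G N \<one> = \<one>"
  using subgroup.one_closed by (auto simp: coset_rep_def)

lemma (in group) coset_rep_coset_rep:
  assumes N: "subgroup N G" and x: "x \<in> carrier G"
  shows "coset_rep G N (coset_rep G N x) = coset_rep G N x"
  using coset_rep_decomp[OF assms] coset_rep_mult[OF N] by metis

lemma (in group) coset_rep_eq_one:
  assumes N: "subgroup N G" and x: "x \<in> carrier G"
  shows "coset_rep G N x = \<one> \<longleftrightarrow> x \<in> N"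
proof
  assume "coset_rep G N x = \<one>"
  then show "x \<in> N" using coset_rep_decomp(2)[OF N x] N subgroup.mem_carrier by fastforce
qed (simp add: coset_rep_def)

lemma (in group) coset_rep_eqD:
  assumes N: "subgroup N G" and x: "x \<in> carrier G" "y \<in> carrier G"
    and eq: "coset_rep G N x = coset_rep G N y"
  shows "\<exists>n\<in>N. x = n \<otimes> y"
proof -
  obtain n m where nm: "n \<in> N" "m \<in> N" "x = n \<otimes> coset_rep G N x" "y = m \<otimes> coset_rep G N x"
    using coset_rep_decomp(2)[OF N] x eq by metis
  have car: "n \<in> carrier G" "m \<in> carrier G" "coset_rep G N x \<in> carrier G"
    using nm N subgroup.mem_carrier coset_rep_decomp x by metis+
  have "inv m \<otimes> y = coset_rep G N x" using nm(4) car by (metis cancel_inv(1))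
  then have "x = (n \<otimes> inv m) \<otimes> y" using nm(3) car x by (simp add: m_assoc)
  moreover have "n \<otimes> inv m \<in> N" using nm N by (meson subgroup.m_closed subgroup.m_inv_closed)
  ultimately show ?thesis by blast
qed

text \<open>By centrality the element of \<open>N\<close> in \<open>y\<close> moves past
  \<open>x\<close>. This is multiplication in the quotient by \<open>N\<close> written on
  representatives, and it makes the action on reduced words multiplicative.\<close>

lemma (in group) coset_rep_mult_coset_rep:
  assumes N: "subgroup N G" "N \<subseteq> centre G" and x: "x \<in> carrier G" "y \<in> carrier G"
  shows "coset_rep G N (x \<otimes> coset_rep G N y) = coset_rep G N (x \<otimes> y)"
proof -
  let ?r = "coset_rep G N y"
  obtain n where n: "n \<in> N" "y = n \<otimes> ?r" using coset_rep_decomp(2)[OF N(1) x(2)] by blast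
  have r: "?r \<in> carrier G" "n \<in> carrier G"
    using coset_rep_decomp(1)[OF N(1) x(2)] N n subgroup.mem_carrier by auto
  have "x \<otimes> y = x \<otimes> (n \<otimes> ?r)" using n(2) by simp
  also have "\<dots> = (x \<otimes> n) \<otimes> ?r" using r x by (simp add: m_assoc)
  also have "x \<otimes> n = n \<otimes> x" using centreD[of n G x] n N x by auto
  also have "(n \<otimes> x) \<otimes> ?r = n \<otimes> (x \<otimes> ?r)" using r x by (simp add: m_assoc)
  finally show ?thesis using coset_rep_mult[OF N(1) _ n(1)] r x by simp
qed

lemma Plus_iff [simp]: "Inl x \<in> C <+> D \<longleftrightarrow> x \<in> C" "Inr y \<in> C <+> D \<longleftrightarrow> y \<in> D"
  by auto

text \<open>\<open>A\<close> may be any central subgroup: the trivial one gives the free product,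
  the full centre the amalgam over centres.\<close>

locale central_identification = G1: group G1 + G2: group G2
  for G1 :: "('a, 'm) monoid_scheme" and G2 :: "('b, 'n) monoid_scheme" +
  fixes A :: "'a set" and \<phi> :: "'a \<Rightarrow> 'b"
  assumes A: "subgroup A G1" "A \<subseteq> centre G1"
    and \<phi>: "\<phi> \<in> hom (G1\<lparr>carrier := A\<rparr>) G2" "inj_on \<phi> A" "\<phi> ` A \<subseteq> centre G2"
begin

abbreviation B :: "'b set" where "B \<equiv> \<phi> ` A"

abbreviation P :: "('a + 'b) list set monoid" where "P \<equiv> amalgamated_product G1 G2 A \<phi>"

abbreviation R :: "('a \<times> 'b) set" where "R \<equiv> {(a, \<phi> a) |a. a \<in> A}"

lemma B: "subgroup B G2" "B \<subseteq> centre G2"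
proof -
  interpret A: group_hom "G1\<lparr>carrier := A\<rparr>" G2 \<phi>
    using \<phi>(1) G1.subgroup_imp_group[OF A(1)] G2.is_group
    by (simp add: group_hom_def group_hom_axioms_def)
  show "subgroup B G2" using A.img_is_subgroup by simp
qed (rule \<phi>(3))

definition "rep1 = coset_rep G1 A"

definition "rep2 = coset_rep G2 B"

lemmas rep1 = G1.coset_rep_decomp(1)[OF A(1), folded rep1_def] G1.coset_rep_mult[OF A(1), folded rep1_def]
  G1.coset_rep_one[OF A(1), folded rep1_def] G1.coset_rep_coset_rep[OF A(1), folded rep1_def]
  G1.coset_rep_eq_one[OF A(1), folded rep1_def] G1.coset_rep_mult_coset_rep[OF A, folded rep1_def]

lemmas rep2 = G2.coset_rep_decomp(1)[OF B(1), folded rep2_def] G2.coset_rep_mult[OF B(1), folded rep2_def]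
  G2.coset_rep_one[OF B(1), folded rep2_def] G2.coset_rep_coset_rep[OF B(1), folded rep2_def]
  G2.coset_rep_eq_one[OF B(1), folded rep2_def] G2.coset_rep_mult_coset_rep[OF B, folded rep2_def]

section \<open>The action on reduced words\<close>

text \<open>The default unit matches \<open>cons1\<close>, which drops units: every reduced word
  splits as \<open>cons1 (hd1 w) (tl1 w)\<close>, whether or not it starts with an
  \<open>Inl\<close> letter, and the action needs no case distinction.\<close>

fun hd1 :: "('a + 'b) list \<Rightarrow> 'a" where
  "hd1 (Inl x # w) = x" | "hd1 w = \<one>\<^bsub>G1\<^esub>"

fun hd2 :: "('a + 'b) list \<Rightarrow> 'b" where
  "hd2 (Inr y # w) = y" | "hd2 w = \<one>\<^bsub>G2\<^esub>"

fun tl1 :: "('a + 'b) list \<Rightarrow> ('a + 'b) list" where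
  "tl1 (Inl x # w) = w" | "tl1 w = w"

fun tl2 :: "('a + 'b) list \<Rightarrow> ('a + 'b) list" where
  "tl2 (Inr x # w) = w" | "tl2 w = w"

definition "cons1 x w = (if x = \<one>\<^bsub>G1\<^esub> then w else Inl x # w)"

definition "cons2 y w = (if y = \<one>\<^bsub>G2\<^esub> then w else Inr y # w)"

text \<open>The action of van der Waerden on reduced words, with letters taken modulo the amalgamated
  subgroup.\<close>

fun act :: "'a + 'b \<Rightarrow> ('a + 'b) list \<Rightarrow> ('a + 'b) list" where
  "act (Inl x) w = cons1 (rep1 (x \<otimes>\<^bsub>G1\<^esub> hd1 w)) (tl1 w)"
| "act (Inr y) w = cons2 (rep2 (y \<otimes>\<^bsub>G2\<^esub> hd2 w)) (tl2 w)"

text \<open>As reduced words contain no unit letters, a unit value of \<open>hd1 w\<close> says that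
  \<open>w\<close> does not start with another \<open>Inl\<close> letter; likewise for
  \<open>hd2\<close>.\<close>

fun reduced :: "('a + 'b) list \<Rightarrow> bool" where
  "reduced [] = True"
| "reduced (Inl x # w) = (x \<in> carrier G1 \<and> rep1 x = x \<and> x \<noteq> \<one>\<^bsub>G1\<^esub> \<and> hd1 w = \<one>\<^bsub>G1\<^esub> \<and> reduced w)"
| "reduced (Inr y # w) = (y \<in> carrier G2 \<and> rep2 y = y \<and> y \<noteq> \<one>\<^bsub>G2\<^esub> \<and> hd2 w = \<one>\<^bsub>G2\<^esub> \<and> reduced w)"

lemma reduced_split1:
  assumes "reduced w"
  shows "hd1 w \<in> carrier G1" "rep1 (hd1 w) = hd1 w" "cons1 (hd1 w) (tl1 w) = w"
    "hd1 (tl1 w) = \<one>\<^bsub>G1\<^esub>" "reduced (tl1 w)"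
  using assms by (induction w rule: reduced.induct) (auto simp: cons1_def rep1)

lemma reduced_split2:
  assumes "reduced w"
  shows "hd2 w \<in> carrier G2" "rep2 (hd2 w) = hd2 w" "cons2 (hd2 w) (tl2 w) = w"
    "hd2 (tl2 w) = \<one>\<^bsub>G2\<^esub>" "reduced (tl2 w)"
  using assms by (induction w rule: reduced.induct) (auto simp: cons2_def rep2)

lemma reduced_cons1:
  assumes "reduced w" "hd1 w = \<one>\<^bsub>G1\<^esub>" "x \<in> carrier G1" "rep1 x = x"
  shows "reduced (cons1 x w)" "hd1 (cons1 x w) = x" "tl1 (cons1 x w) = w"
  using assms by (induction w rule: reduced.induct) (auto simp: cons1_def)

lemma reduced_cons2:
  assumes "reduced w" "hd2 w = \<one>\<^bsub>G2\<^esub>" "x \<in> carrier G2" "rep2 x = x"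
  shows "reduced (cons2 x w)" "hd2 (cons2 x w) = x" "tl2 (cons2 x w) = w"
  using assms by (induction w rule: reduced.induct) (auto simp: cons2_def)

lemma reduced_act:
  assumes "reduced w" "l \<in> carrier G1 <+> carrier G2"
  shows "reduced (act l w)"
  using assms reduced_split1[OF assms(1)] reduced_split2[OF assms(1)]
  by (cases l) (auto intro!: reduced_cons1 reduced_cons2 simp: rep1 rep2)

lemma act_mult1:
  assumes "reduced w" "x \<in> carrier G1" "y \<in> carrier G1"
  shows "act (Inl x) (act (Inl y) w) = act (Inl (x \<otimes>\<^bsub>G1\<^esub> y)) w"
  using assms reduced_split1[OF assms(1)]
  by (simp add: reduced_cons1 rep1 G1.m_assoc)

lemma act_mult2:
  assumes "reduced w" "x \<in> carrier G2" "y \<in> carrier G2"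
  shows "act (Inr x) (act (Inr y) w) = act (Inr (x \<otimes>\<^bsub>G2\<^esub> y)) w"
  using assms reduced_split2[OF assms(1)]
  by (simp add: reduced_cons2 rep2 G2.m_assoc)

text \<open>Together with the same fact for \<open>B\<close>, this makes \<open>act\<close> an
  action of the free product of the quotients by \<open>A\<close> and \<open>B\<close>; it sees
  letters only modulo these subgroups.\<close>

lemma act_A: "reduced w \<Longrightarrow> a \<in> A \<Longrightarrow> act (Inl a) w = w"
  using reduced_split1[of w] by (simp add: rep1)

lemma act_B: "reduced w \<Longrightarrow> b \<in> B \<Longrightarrow> act (Inr b) w = w"
  using reduced_split2[of w] by (simp add: rep2)

lemma reduced_foldr_act: "u \<in> words G1 G2 \<Longrightarrow> reduced w \<Longrightarrow> reduced (foldr act u w)"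
  unfolding words_def by (induction u) (auto intro: reduced_act)

lemma word_eq_in_words: "word_eq G1 G2 R u v \<Longrightarrow> u \<in> words G1 G2 \<and> v \<in> words G1 G2"
  using word_eq_words G1.is_group G2.is_group by blast

text \<open>All reduced \<open>w\<close> are needed at once, since in the \<open>append\<close> case
  the left word acts on the result of the right one.\<close>

lemma foldr_act_word_eq:
  "word_eq G1 G2 R u v \<Longrightarrow> reduced w \<Longrightarrow> foldr act u w = foldr act v w"
proof (induction arbitrary: w rule: word_eq.induct)
  case (append u u' v v')
  have "reduced (foldr act v w)"
    using append word_eq_in_words reduced_foldr_act by blast
  then show ?case using append by simp
next
  case (amalg x y)
  then show ?case using act_A act_B by auto
next
  case one_left
  then show ?case using act_A A(1) subgroup.one_closed by fastforce
next
  case one_right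
  then show ?case using act_B B(1) subgroup.one_closed by fastforce
next
  case (mult_left x x')
  then show ?case using act_mult1 by simp
next
  case (mult_right x x')
  then show ?case using act_mult2 by simp
qed simp_all

definition letters :: "bool \<Rightarrow> ('a + 'b) set" where
  "letters i = (if i then Inl ` (carrier G1 - A) else Inr ` (carrier G2 - B))"

text \<open>Acting on the empty word, an alternating word writes down its own representatives. The
  clauses on head and tail strengthen the induction: the result does not begin in the opposite
  factor, so a letter from there is put in front without merging.\<close>

lemma foldr_act_alternating:
  assumes "alternating letters i t"
  shows "foldr act t [] = map (map_sum rep1 rep2) t \<and> reduced (map (map_sum rep1 rep2) t) \<and>
    (if i then hd2 (map (map_sum rep1 rep2) t) = \<one>\<^bsub>G2\<^esub> \<and> tl2 (map (map_sum rep1 rep2) t) = map (map_sum rep1 rep2) t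
     else hd1 (map (map_sum rep1 rep2) t) = \<one>\<^bsub>G1\<^esub> \<and> tl1 (map (map_sum rep1 rep2) t) = map (map_sum rep1 rep2) t)"
  using assms
proof (induction t arbitrary: i)
  case (Cons l t)
  then show ?case using Cons.IH[of "\<not> i"]
    by (cases i) (auto simp: letters_def rep1 rep2 cons1_def cons2_def)
qed simp

lemma \<phi>_mult: "a \<in> A \<Longrightarrow> b \<in> A \<Longrightarrow> \<phi> (a \<otimes>\<^bsub>G1\<^esub> b) = \<phi> a \<otimes>\<^bsub>G2\<^esub> \<phi> b"
  using \<phi>(1) by (auto simp: hom_def)

lemma A_carrier: "a \<in> A \<Longrightarrow> a \<in> carrier G1"
  using A(1) subgroup.mem_carrier by metis

lemma \<phi>_carrier: "a \<in> A \<Longrightarrow> \<phi> a \<in> carrier G2"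
  using B(1) subgroup.mem_carrier by fastforce

lemma one_in_A: "\<one>\<^bsub>G1\<^esub> \<in> A"
  using A(1) subgroup.one_closed by metis

lemma \<phi>_one: "\<phi> \<one>\<^bsub>G1\<^esub> = \<one>\<^bsub>G2\<^esub>"
  using \<phi>_mult[OF one_in_A one_in_A] \<phi>_carrier[OF one_in_A] by (simp add: G2.r_cancel_one')

lemma \<phi>_eq_one_iff: "a \<in> A \<Longrightarrow> \<phi> a = \<one>\<^bsub>G2\<^esub> \<longleftrightarrow> a = \<one>\<^bsub>G1\<^esub>"
  using \<phi>(2) \<phi>_one one_in_A by (metis inj_onD)

section \<open>Coordinates in the central product\<close>

fun prod1 :: "('a + 'b) list \<Rightarrow> 'a" where
  "prod1 [] = \<one>\<^bsub>G1\<^esub>"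
| "prod1 (Inl x # u) = x \<otimes>\<^bsub>G1\<^esub> prod1 u"
| "prod1 (Inr y # u) = prod1 u"

fun prod2 :: "('a + 'b) list \<Rightarrow> 'b" where
  "prod2 [] = \<one>\<^bsub>G2\<^esub>"
| "prod2 (Inl x # u) = prod2 u"
| "prod2 (Inr y # u) = y \<otimes>\<^bsub>G2\<^esub> prod2 u"

lemma prod_closed: "u \<in> words G1 G2 \<Longrightarrow> prod1 u \<in> carrier G1 \<and> prod2 u \<in> carrier G2"
  unfolding words_def
proof (induction u)
  case (Cons l u)
  then show ?case by (cases l) auto
qed simp

lemma prod_append:
  "u \<in> words G1 G2 \<Longrightarrow> v \<in> words G1 G2 \<Longrightarrow>
    prod1 (u @ v) = prod1 u \<otimes>\<^bsub>G1\<^esub> prod1 v \<and> prod2 (u @ v) = prod2 u \<otimes>\<^bsub>G2\<^esub> prod2 v"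
proof (induction u)
  case Nil
  then show ?case using prod_closed by simp
next
  case (Cons l u)
  then have u: "u \<in> words G1 G2" "l \<in> carrier G1 <+> carrier G2" by (auto simp: words_def)
  then show ?case using Cons prod_closed[OF u(1)] prod_closed[of v]
    by (cases l) (auto simp: G1.m_assoc G2.m_assoc)
qed

text \<open>The two coordinates of a homomorphism into the central product, the quotient of the direct
  product by the subgroup of all \<^term>\<open>(a, inv\<^bsub>G2\<^esub> (\<phi> a))\<close>.\<close>

lemma prod_word_eq:
  "word_eq G1 G2 R u v \<Longrightarrow> \<exists>a\<in>A. prod1 u = prod1 v \<otimes>\<^bsub>G1\<^esub> a \<and> prod2 v = prod2 u \<otimes>\<^bsub>G2\<^esub> \<phi> a"
proof (induction rule: word_eq.induct)
  case (refl u)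
  then show ?case using prod_closed[OF refl] one_in_A \<phi>_one by (intro bexI[of _ "\<one>\<^bsub>G1\<^esub>"]) auto
next
  case (sym u v)
  then obtain a where a: "a \<in> A" "prod1 u = prod1 v \<otimes>\<^bsub>G1\<^esub> a" "prod2 v = prod2 u \<otimes>\<^bsub>G2\<^esub> \<phi> a" by blast
  have i: "inv\<^bsub>G1\<^esub> a \<in> A" using A(1) a(1) subgroup.m_inv_closed by metis
  have "\<phi> a \<otimes>\<^bsub>G2\<^esub> \<phi> (inv\<^bsub>G1\<^esub> a) = \<one>\<^bsub>G2\<^esub>"
    using \<phi>_mult[OF a(1) i] \<phi>_one A_carrier[OF a(1)] by simp
  then show ?case
    using a i prod_closed word_eq_in_words[OF sym.hyps] A_carrier[OF a(1)] \<phi>_carrier[OF a(1)] \<phi>_carrier[OF i]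
    by (intro bexI[of _ "inv\<^bsub>G1\<^esub> a"]) (auto simp: G1.m_assoc G2.m_assoc)
next
  case (trans u v w)
  then obtain a b where a: "a \<in> A" "prod1 u = prod1 v \<otimes>\<^bsub>G1\<^esub> a" "prod2 v = prod2 u \<otimes>\<^bsub>G2\<^esub> \<phi> a"
    and b: "b \<in> A" "prod1 v = prod1 w \<otimes>\<^bsub>G1\<^esub> b" "prod2 w = prod2 v \<otimes>\<^bsub>G2\<^esub> \<phi> b" by blast
  have ab: "b \<otimes>\<^bsub>G1\<^esub> a \<in> A" using a b A(1) subgroup.m_closed by metis
  have "\<phi> a \<otimes>\<^bsub>G2\<^esub> \<phi> b = \<phi> b \<otimes>\<^bsub>G2\<^esub> \<phi> a"
    using centreD[of "\<phi> a" G2 "\<phi> b"] \<phi>(3) a b \<phi>_carrier by blast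
  moreover have "prod1 w \<in> carrier G1" "prod2 u \<in> carrier G2"
    using prod_closed word_eq_in_words trans.hyps by blast+
  moreover have "prod1 u = (prod1 w \<otimes>\<^bsub>G1\<^esub> b) \<otimes>\<^bsub>G1\<^esub> a" "prod2 w = (prod2 u \<otimes>\<^bsub>G2\<^esub> \<phi> a) \<otimes>\<^bsub>G2\<^esub> \<phi> b"
    using a b by simp_all
  ultimately show ?case
    using A_carrier[OF a(1)] A_carrier[OF b(1)] \<phi>_carrier[OF a(1)] \<phi>_carrier[OF b(1)] ab \<phi>_mult[OF b(1) a(1)]
    by (intro bexI[OF _ ab]) (simp add: G1.m_assoc G2.m_assoc)
next
  case (append u u' v v')
  then obtain a b where a: "a \<in> A" "prod1 u = prod1 u' \<otimes>\<^bsub>G1\<^esub> a" "prod2 u' = prod2 u \<otimes>\<^bsub>G2\<^esub> \<phi> a"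
    and b: "b \<in> A" "prod1 v = prod1 v' \<otimes>\<^bsub>G1\<^esub> b" "prod2 v' = prod2 v \<otimes>\<^bsub>G2\<^esub> \<phi> b" by blast
  have w: "u \<in> words G1 G2" "u' \<in> words G1 G2" "v \<in> words G1 G2" "v' \<in> words G1 G2"
    using word_eq_in_words append.hyps by blast+
  have ab: "a \<otimes>\<^bsub>G1\<^esub> b \<in> A" using a b A(1) subgroup.m_closed by metis
  have c: "a \<in> carrier G1" "b \<in> carrier G1" "\<phi> a \<in> carrier G2" "\<phi> b \<in> carrier G2"
    using a b A_carrier \<phi>_carrier by auto
  \<comment> \<open>The corrections are central and so move past the second word.\<close>
  have com: "a \<otimes>\<^bsub>G1\<^esub> prod1 v' = prod1 v' \<otimes>\<^bsub>G1\<^esub> a" "\<phi> a \<otimes>\<^bsub>G2\<^esub> prod2 v = prod2 v \<otimes>\<^bsub>G2\<^esub> \<phi> a"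
    using centreD[of a G1 "prod1 v'"] centreD[of "\<phi> a" G2 "prod2 v"] A(2) \<phi>(3) a w prod_closed by blast+
  have "prod1 (u @ v) = prod1 u' \<otimes>\<^bsub>G1\<^esub> (a \<otimes>\<^bsub>G1\<^esub> prod1 v') \<otimes>\<^bsub>G1\<^esub> b"
    using a b w c prod_append prod_closed by (simp add: G1.m_assoc)
  then have 1: "prod1 (u @ v) = prod1 (u' @ v') \<otimes>\<^bsub>G1\<^esub> (a \<otimes>\<^bsub>G1\<^esub> b)"
    using com w c prod_append prod_closed by (simp add: G1.m_assoc)
  have "prod2 (u' @ v') = prod2 u \<otimes>\<^bsub>G2\<^esub> (\<phi> a \<otimes>\<^bsub>G2\<^esub> prod2 v) \<otimes>\<^bsub>G2\<^esub> \<phi> b"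
    using a b w c prod_append prod_closed by (simp add: G2.m_assoc)
  then have "prod2 (u' @ v') = prod2 (u @ v) \<otimes>\<^bsub>G2\<^esub> \<phi> (a \<otimes>\<^bsub>G1\<^esub> b)"
    using com w c prod_append prod_closed \<phi>_mult[OF a(1) b(1)] by (simp add: G2.m_assoc)
  with 1 ab show ?case by blast
next
  case (amalg x y)
  then show ?case using \<phi>_carrier by (intro bexI[of _ x]) auto
qed (use one_in_A \<phi>_one in \<open>auto intro!: bexI[of _ "\<one>\<^bsub>G1\<^esub>"]\<close>)

section \<open>The factors inside the amalgamated product\<close>

definition word_class :: "('a + 'b) list \<Rightarrow> ('a + 'b) list set" where
  "word_class u = word_rel G1 G2 R `` {u}"

lemma group_P: "group P"
  unfolding amalgamated_product_def
  using group_free_product_mod G1.is_group G2.is_group by blast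

sublocale P: group P by (rule group_P)

lemma carrier_P: "carrier P = word_class ` words G1 G2"
  by (auto simp: amalgamated_product_def free_product_mod_def quotient_def word_class_def)

lemma one_P: "\<one>\<^bsub>P\<^esub> = word_class []"
  by (simp add: amalgamated_product_def free_product_mod_def word_class_def)

lemma word_class_append:
  "u \<in> words G1 G2 \<Longrightarrow> v \<in> words G1 G2 \<Longrightarrow> word_class u \<otimes>\<^bsub>P\<^esub> word_class v = word_class (u @ v)"
  unfolding amalgamated_product_def word_class_def
  using free_product_mod_mult G1.is_group G2.is_group by blast

lemma word_class_eq_iff:
  "u \<in> words G1 G2 \<Longrightarrow> v \<in> words G1 G2 \<Longrightarrow> word_class u = word_class v \<longleftrightarrow> word_eq G1 G2 R u v"
  unfolding word_class_def
  using eq_equiv_class_iff[OF equiv_word_rel[OF G1.is_group G2.is_group], of u v R]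
  by (simp add: word_rel_def)

abbreviation letter :: "'a + 'b \<Rightarrow> ('a + 'b) list set" where "letter l \<equiv> word_class [l]"

abbreviation emb1 :: "'a \<Rightarrow> ('a + 'b) list set" where "emb1 x \<equiv> letter (Inl x)"

abbreviation emb2 :: "'b \<Rightarrow> ('a + 'b) list set" where "emb2 y \<equiv> letter (Inr y)"

lemma singleton_words [simp]:
  "[Inl x] \<in> words G1 G2 \<longleftrightarrow> x \<in> carrier G1" "[Inr y] \<in> words G1 G2 \<longleftrightarrow> y \<in> carrier G2"
  by (auto simp: words_def)

lemma word_class_Cons:
  "l \<in> carrier G1 <+> carrier G2 \<Longrightarrow> u \<in> words G1 G2 \<Longrightarrow> word_class (l # u) = letter l \<otimes>\<^bsub>P\<^esub> word_class u"
  using word_class_append[of "[l]" u] by (simp add: words_def)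

lemma letter_carrier: "l \<in> carrier G1 <+> carrier G2 \<Longrightarrow> letter l \<in> carrier P"
  by (auto simp: carrier_P words_def)

lemma emb1_mult:
  "x \<in> carrier G1 \<Longrightarrow> y \<in> carrier G1 \<Longrightarrow> emb1 x \<otimes>\<^bsub>P\<^esub> emb1 y = emb1 (x \<otimes>\<^bsub>G1\<^esub> y)"
  using word_class_append[of "[Inl x]" "[Inl y]"] word_eq.mult_left[of x G1 y G2 R]
    word_class_eq_iff[of "[Inl x, Inl y]" "[Inl (x \<otimes>\<^bsub>G1\<^esub> y)]"] by (simp add: words_def)

lemma emb2_mult:
  "x \<in> carrier G2 \<Longrightarrow> y \<in> carrier G2 \<Longrightarrow> emb2 x \<otimes>\<^bsub>P\<^esub> emb2 y = emb2 (x \<otimes>\<^bsub>G2\<^esub> y)"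
  using word_class_append[of "[Inr x]" "[Inr y]"] word_eq.mult_right[of x G2 y G1 R]
    word_class_eq_iff[of "[Inr x, Inr y]" "[Inr (x \<otimes>\<^bsub>G2\<^esub> y)]"] by (simp add: words_def)

lemma emb_hom: "emb1 \<in> hom G1 P" "emb2 \<in> hom G2 P"
  using emb1_mult emb2_mult letter_carrier by (auto simp: hom_def)

text \<open>The action is blind to \<open>A\<close>, so the central product is used instead: for two
  letters of the same factor the other coordinate is a unit on both sides, which makes the
  correction by \<open>a\<close> trivial.\<close>

lemma emb_inj: "inj_on emb1 (carrier G1)" "inj_on emb2 (carrier G2)"
proof -
  show "inj_on emb1 (carrier G1)"
  proof (rule inj_onI)
    fix x y assume x: "x \<in> carrier G1" "y \<in> carrier G1" "emb1 x = emb1 y"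
    then obtain a where "a \<in> A" "x = y \<otimes>\<^bsub>G1\<^esub> a" "\<one>\<^bsub>G2\<^esub> = \<phi> a"
      using prod_word_eq[of "[Inl x]" "[Inl y]"] word_class_eq_iff[of "[Inl x]" "[Inl y]"] \<phi>_carrier by auto
    then show "x = y" using \<phi>_eq_one_iff[of a] x(2) by simp
  qed
  show "inj_on emb2 (carrier G2)"
  proof (rule inj_onI)
    fix x y assume x: "x \<in> carrier G2" "y \<in> carrier G2" "emb2 x = emb2 y"
    then obtain a where "a \<in> A" "\<one>\<^bsub>G1\<^esub> = a" "y = x \<otimes>\<^bsub>G2\<^esub> \<phi> a"
      using prod_word_eq[of "[Inr x]" "[Inr y]"] word_class_eq_iff[of "[Inr x]" "[Inr y]"] A_carrier by auto
    then show "x = y" using \<phi>_one x by auto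
  qed
qed

lemma emb_amalgam: "a \<in> A \<Longrightarrow> emb1 a = emb2 (\<phi> a)"
  using word_eq.amalg[of a "\<phi> a" R G1 G2] word_class_eq_iff[of "[Inl a]" "[Inr (\<phi> a)]"]
    A_carrier \<phi>_carrier by auto

lemma emb_A_image: "emb1 ` A = emb2 ` B"
  by (simp add: image_image emb_amalgam cong: image_cong)

definition factors :: "bool \<Rightarrow> ('a + 'b) list set set" where
  "factors i = (if i then emb1 ` carrier G1 else emb2 ` carrier G2)"

lemma emb1_in_A_iff: "x \<in> carrier G1 \<Longrightarrow> emb1 x \<in> emb1 ` A \<longleftrightarrow> x \<in> A"
  using inj_on_image_mem_iff[OF emb_inj(1)] A_carrier by blast

lemma emb2_in_A_iff: "y \<in> carrier G2 \<Longrightarrow> emb2 y \<in> emb1 ` A \<longleftrightarrow> y \<in> B"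
  using inj_on_image_mem_iff[OF emb_inj(2), of y B] \<phi>_carrier by (auto simp: emb_A_image)

lemma letter_lift:
  assumes "x \<in> factors i - emb1 ` A"
  shows "\<exists>l\<in>letters i. x = letter l"
  using assms emb1_in_A_iff emb2_in_A_iff unfolding factors_def letters_def
  by (cases i) auto

lemma letters_words: "alternating letters i t \<Longrightarrow> t \<in> words G1 G2"
proof (induction t arbitrary: i)
  case (Cons l t)
  then have "t \<in> words G1 G2" "l \<in> letters i" by auto
  then show ?case by (cases i) (auto simp: letters_def words_def)
qed (simp add: words_def)

lemma word_prod_letters: "t \<in> words G1 G2 \<Longrightarrow> P.word_prod (map letter t) = word_class t"
proof (induction t)
  case Nil
  then show ?case by (simp add: one_P)
next
  case (Cons l t)
  then have "l \<in> carrier G1 <+> carrier G2" "t \<in> words G1 G2" by (auto simp: words_def)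
  then show ?case using Cons.IH word_class_Cons by simp
qed

lemma alternating_lift:
  assumes "alternating (\<lambda>i. factors i - emb1 ` A) i u"
  shows "\<exists>t. alternating letters i t \<and> u = map letter t"
  using assms
proof (induction u arbitrary: i)
  case (Cons x u)
  then obtain t where t: "alternating letters (\<not> i) t" "u = map letter t" by auto
  obtain l where "l \<in> letters i" "x = letter l" using Cons.prems letter_lift[of x i] by auto
  with t show ?case by (intro exI[of _ "l # t"]) simp
qed simp

text \<open>The action yields equal representatives in \<open>G1\<close> or \<open>G2\<close>; this
  turns them into equal cosets of the amalgamated subgroup in \<open>P\<close>, as uniqueness of
  letters requires.\<close>

lemma letter_coset_eq:
  assumes "l \<in> carrier G1 <+> carrier G2" "k \<in> carrier G1 <+> carrier G2"
    and "map_sum rep1 rep2 l = map_sum rep1 rep2 k"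
  shows "emb1 ` A #>\<^bsub>P\<^esub> letter l = emb1 ` A #>\<^bsub>P\<^esub> letter k"
proof -
  interpret emb1: group_hom G1 P emb1
    using emb_hom G1.is_group P.is_group by (simp add: group_hom_def group_hom_axioms_def)
  have sub: "subgroup (emb1 ` A) P" using emb1.subgroup_img_is_subgroup A(1) by blast
  have "\<exists>a\<in>A. letter l = emb1 a \<otimes>\<^bsub>P\<^esub> letter k"
  proof (cases l)
    case (Inl x)
    with assms obtain y where y: "k = Inl y" "rep1 x = rep1 y" "x \<in> carrier G1" "y \<in> carrier G1"
      by (cases k) auto
    then obtain a where "a \<in> A" "x = a \<otimes>\<^bsub>G1\<^esub> y"
      using G1.coset_rep_eqD[OF A(1), folded rep1_def] by blast
    then show ?thesis using emb1_mult[of a y] A_carrier y Inl by auto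
  next
    case (Inr x)
    with assms obtain y where y: "k = Inr y" "rep2 x = rep2 y" "x \<in> carrier G2" "y \<in> carrier G2"
      by (cases k) auto
    then obtain a where "a \<in> A" "x = \<phi> a \<otimes>\<^bsub>G2\<^esub> y"
      using G2.coset_rep_eqD[OF B(1), folded rep2_def] by blast
    then show ?thesis using emb2_mult[of "\<phi> a" y] \<phi>_carrier emb_amalgam y Inr by auto
  qed
  then have "letter l \<in> emb1 ` A #>\<^bsub>P\<^esub> letter k" by (auto simp: r_coset_def)
  then show ?thesis using P.repr_independence[OF _ letter_carrier[OF assms(2)] sub] by simp
qed

lemma emb_A_commute:
  assumes "a \<in> A" "u \<in> words G1 G2"
  shows "emb1 a \<otimes>\<^bsub>P\<^esub> word_class u = word_class u \<otimes>\<^bsub>P\<^esub> emb1 a"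
  using assms(2)
proof (induction u)
  case Nil
  then show ?case using letter_carrier[of "Inl a"] A_carrier[OF assms(1)] by (simp flip: one_P)
next
  case (Cons l u)
  then have l: "l \<in> carrier G1 <+> carrier G2" "u \<in> words G1 G2" by (auto simp: words_def)
  have "emb1 a \<otimes>\<^bsub>P\<^esub> letter l = letter l \<otimes>\<^bsub>P\<^esub> emb1 a"
  proof (cases l)
    case (Inl x)
    then show ?thesis using l centreD[of a G1 x] A(2) assms(1) emb1_mult A_carrier by auto
  next
    case (Inr y)
    then show ?thesis using l centreD[of "\<phi> a" G2 y] \<phi>(3) assms(1) emb2_mult emb_amalgam \<phi>_carrier by auto
  qed
  moreover have "emb1 a \<in> carrier P" "letter l \<in> carrier P" "word_class u \<in> carrier P"
    using letter_carrier A_carrier assms l carrier_P by auto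
  ultimately show ?case using Cons.IH[OF l(2)] word_class_Cons[OF l] by (metis P.m_assoc)
qed

sublocale central_amalgam P factors "emb1 ` A"
proof (intro central_amalgam.intro central_amalgam_axioms.intro group_P)
  interpret emb1: group_hom G1 P emb1
    using emb_hom G1.is_group P.is_group by (simp add: group_hom_def group_hom_axioms_def)
  interpret emb2: group_hom G2 P emb2
    using emb_hom G2.is_group P.is_group by (simp add: group_hom_def group_hom_axioms_def)
  show "subgroup (factors i) P" for i
    using emb1.img_is_subgroup emb2.img_is_subgroup by (simp add: factors_def)
  show "subgroup (emb1 ` A) P" using emb1.subgroup_img_is_subgroup A(1) by blast
  show "emb1 ` A \<subseteq> factors i" for i
    using emb_amalgam A_carrier \<phi>_carrier by (auto simp: factors_def)
  show "factors True \<inter> factors False \<subseteq> emb1 ` A"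
  proof
    fix g assume "g \<in> factors True \<inter> factors False"
    then obtain x y where xy: "g = emb1 x" "emb1 x = emb2 y" "x \<in> carrier G1" "y \<in> carrier G2"
      by (auto simp: factors_def)
    \<comment> \<open>Acting on the empty word, \<open>Inl x\<close> can only produce an
      \<open>Inl\<close> letter and \<open>Inr y\<close> only an \<open>Inr\<close> letter; equal
      results must be empty.\<close>
    then have "act (Inl x) [] = act (Inr y) []"
      using foldr_act_word_eq[of "[Inl x]" "[Inr y]" "[]"] word_class_eq_iff[of "[Inl x]" "[Inr y]"] by simp
    then have "rep1 x = \<one>\<^bsub>G1\<^esub>" using xy by (auto simp: cons1_def cons2_def split: if_splits)
    then show "g \<in> emb1 ` A" using xy rep1(5) by auto
  qed
  show "z \<otimes>\<^bsub>P\<^esub> g = g \<otimes>\<^bsub>P\<^esub> z" if "z \<in> emb1 ` A" "g \<in> carrier P" for z g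
    using that emb_A_commute by (auto simp: carrier_P)
  show "\<exists>u. set u \<subseteq> factors True \<union> factors False \<and> g = P.word_prod u" if "g \<in> carrier P" for g
  proof -
    obtain t where t: "t \<in> words G1 G2" "g = word_class t" using \<open>g \<in> carrier P\<close> by (auto simp: carrier_P)
    then have "set (map letter t) \<subseteq> factors True \<union> factors False" by (auto simp: factors_def words_def)
    then show ?thesis using t word_prod_letters by metis
  qed
  fix i j u v z
  assume u: "alternating (\<lambda>i. factors i - emb1 ` A) i u" and v: "alternating (\<lambda>i. factors i - emb1 ` A) j v"
    and z: "z \<in> emb1 ` A" and eq: "P.word_prod u = z \<otimes>\<^bsub>P\<^esub> P.word_prod v"
  obtain t where t: "alternating letters i t" "u = map letter t" using alternating_lift[OF u] by blast
  obtain s where s: "alternating letters j s" "v = map letter s" using alternating_lift[OF v] by blast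
  obtain a where a: "a \<in> A" "z = emb1 a" using z by blast
  note w = letters_words[OF t(1)] letters_words[OF s(1)]
  \<comment> \<open>The central factor \<open>z\<close> becomes one extra letter from
    \<open>A\<close>, which acts trivially.\<close>
  have "word_class t = word_class (Inl a # s)"
    using eq t(2) s(2) a w word_prod_letters word_class_Cons A_carrier by auto
  moreover have "Inl a # s \<in> words G1 G2" using w A_carrier[OF a(1)] by (auto simp: words_def)
  ultimately have "word_eq G1 G2 R t (Inl a # s)" using word_class_eq_iff w by blast
  then have "foldr act t [] = act (Inl a) (foldr act s [])" using foldr_act_word_eq[of t "Inl a # s" "[]"] by simp
  then have "map (map_sum rep1 rep2) t = map (map_sum rep1 rep2) s"
    using foldr_act_alternating[OF t(1)] foldr_act_alternating[OF s(1)] act_A[OF _ a(1)] by simp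
  note eq = this
  have len: "length t = length s" using map_eq_imp_length_eq[OF eq] .
  show "map (r_coset P (emb1 ` A)) u = map (r_coset P (emb1 ` A)) v"
  proof (rule nth_equalityI)
    fix n assume "n < length (map (r_coset P (emb1 ` A)) u)"
    then have n: "n < length t" "n < length s" using len t(2) by auto
    have "map_sum rep1 rep2 (t ! n) = map_sum rep1 rep2 (s ! n)"
      using arg_cong[OF eq, of "\<lambda>w. w ! n"] n by simp
    moreover have "t ! n \<in> carrier G1 <+> carrier G2" "s ! n \<in> carrier G1 <+> carrier G2"
      using w n nth_mem[OF n(1)] nth_mem[OF n(2)] by (auto simp: words_def)
    ultimately have "emb1 ` A #>\<^bsub>P\<^esub> letter (t ! n) = emb1 ` A #>\<^bsub>P\<^esub> letter (s ! n)"
      by (intro letter_coset_eq)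
    then show "map (r_coset P (emb1 ` A)) u ! n = map (r_coset P (emb1 ` A)) v ! n"
      by (simp only: t(2) s(2) nth_map length_map n)
  qed (simp add: len t(2) s(2))
qed

end

section \<open>The centraliser dimension of products\<close>

text \<open>As \<open>\<phi>\<close> maps centre onto centre, both embedded factors have the
  amalgamated subgroup as their centre, and being nonabelian both are larger than it.\<close>

lemma cdim_amalgamated_product_centres:
  assumes G1: "group G1" and G2: "group G2" and n: "\<not> comm_group G1" "\<not> comm_group G2"
    and \<phi>: "\<phi> \<in> iso (G1\<lparr>carrier := centre G1\<rparr>) (G2\<lparr>carrier := centre G2\<rparr>)"
  shows "cdim (amalgamated_product G1 G2 (centre G1) \<phi>) = max (cdim G1) (cdim G2)"
proof -
  have im: "\<phi> ` centre G1 = centre G2" "inj_on \<phi> (centre G1)" "\<phi> \<in> hom (G1\<lparr>carrier := centre G1\<rparr>) G2"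
  proof -
    have "bij_betw \<phi> (centre G1) (centre G2)" "\<phi> \<in> hom (G1\<lparr>carrier := centre G1\<rparr>) (G2\<lparr>carrier := centre G2\<rparr>)"
      using \<phi> by (simp_all add: iso_def)
    moreover have "centre G2 \<subseteq> carrier G2" by (auto simp: centre_def centraliser_def)
    ultimately show "\<phi> ` centre G1 = centre G2" "inj_on \<phi> (centre G1)"
      "\<phi> \<in> hom (G1\<lparr>carrier := centre G1\<rparr>) G2"
      by (auto simp: bij_betw_def hom_def)
  qed
  interpret central_identification G1 G2 "centre G1" \<phi>
    using G1 G2 im subgroup_centre[OF G1]
    by (simp add: central_identification_def central_identification_axioms_def)
  have centre: "centre (P\<lparr>carrier := factors i\<rparr>) = emb1 ` centre G1" for i
    using centre_hom_image[OF emb_hom(1) emb_inj(1) G1] centre_hom_image[OF emb_hom(2) emb_inj(2) G2]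
      emb_A_image im(1) by (simp add: factors_def)
  obtain x y where "x \<in> carrier G1" "x \<notin> centre G1" "y \<in> carrier G2" "y \<notin> centre G2"
    using noncentral_element G1 G2 n by metis
  then have "emb1 x \<in> factors True - emb1 ` centre G1" "emb2 y \<in> factors False - emb1 ` centre G1"
    using emb1_in_A_iff[of x] emb2_in_A_iff[of y] by (simp_all add: factors_def im(1))
  then have "factors i \<noteq> emb1 ` centre G1" for i by (cases i) auto
  from cdim_amalgam_centres[OF centre this] show ?thesis
    using cdim_hom_image[OF emb_hom(1) emb_inj(1) G1 group_P] cdim_hom_image[OF emb_hom(2) emb_inj(2) G2 group_P]
    by (simp add: factors_def)
qed

text \<open>Both unit letters are already equivalent to the empty word, so identifying them adds no
  relation.\<close>

lemma free_product_eq_amalgamated_product: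
  "free_product G H = amalgamated_product G H {\<one>\<^bsub>G\<^esub>} (\<lambda>_. \<one>\<^bsub>H\<^esub>)"
proof -
  let ?R = "{(a, \<one>\<^bsub>H\<^esub>) |a. a \<in> {\<one>\<^bsub>G\<^esub>}}"
  have "word_eq G H {} u v" if "word_eq G H ?R u v" for u v
    using that
  proof induction
    case (amalg x y)
    then show ?case
      using word_eq.trans[OF word_eq.one_left word_eq.sym[OF word_eq.one_right]] by auto
  qed (auto intro: word_eq.intros)
  moreover have "word_eq G H ?R u v" if "word_eq G H {} u v" for u v
    using that by induction (auto intro: word_eq.intros)
  ultimately have "word_rel G H {} = word_rel G H ?R" unfolding word_rel_def by blast
  then show ?thesis by (simp add: free_product_def amalgamated_product_def free_product_mod_def)
qed

text \<open>\<open>proper\<close> excludes a trivial factor beside one with nontrivial centre: the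
  free product is then just the other factor, and for finite dimension the right-hand side would be
  too large by 2.\<close>

lemma cdim_free_product:
  assumes G1: "group G1" and G2: "group G2"
    and proper: "carrier G1 = {\<one>\<^bsub>G1\<^esub>} \<Longrightarrow> centre G2 = {\<one>\<^bsub>G2\<^esub>}"
      "carrier G2 = {\<one>\<^bsub>G2\<^esub>} \<Longrightarrow> centre G1 = {\<one>\<^bsub>G1\<^esub>}"
  shows "cdim (free_product G1 G2) = max (cdim G1 + zz G1) (cdim G2 + zz G2)"
proof -
  interpret G1: group G1 by fact
  interpret G2: group G2 by fact
  interpret central_identification G1 G2 "{\<one>\<^bsub>G1\<^esub>}" "\<lambda>_. \<one>\<^bsub>G2\<^esub>"
    by unfold_locales (auto simp: centre_def centraliser_def hom_def G1.triv_subgroup)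
  note im1 = emb_hom(1) emb_inj(1) G1 and im2 = emb_hom(2) emb_inj(2) G2
  have one: "emb1 \<one>\<^bsub>G1\<^esub> = \<one>\<^bsub>P\<^esub>" "emb2 \<one>\<^bsub>G2\<^esub> = \<one>\<^bsub>P\<^esub>"
    using hom_one[OF emb_hom(1) G1 group_P] hom_one[OF emb_hom(2) G2 group_P] by auto
  have "centre (factor (\<not> i)) = {\<one>\<^bsub>P\<^esub>}" if i: "factors i = {\<one>\<^bsub>P\<^esub>}" for i
  proof (cases i)
    case True
    then have "emb1 ` carrier G1 = emb1 ` {\<one>\<^bsub>G1\<^esub>}" using i one by (simp add: factors_def)
    then have "carrier G1 = {\<one>\<^bsub>G1\<^esub>}" using inj_on_image_eq_iff[OF emb_inj(1), of "carrier G1" "{\<one>\<^bsub>G1\<^esub>}"] by simp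
    then show ?thesis using True proper centre_hom_image[OF im2] one by (simp add: factors_def)
  next
    case False
    then have "emb2 ` carrier G2 = emb2 ` {\<one>\<^bsub>G2\<^esub>}" using i one by (simp add: factors_def)
    then have "carrier G2 = {\<one>\<^bsub>G2\<^esub>}" using inj_on_image_eq_iff[OF emb_inj(2), of "carrier G2" "{\<one>\<^bsub>G2\<^esub>}"] by simp
    then show ?thesis using False proper centre_hom_image[OF im1] one by (simp add: factors_def)
  qed
  then have "cdim P = max (cdim (factor True) + zz (factor True)) (cdim (factor False) + zz (factor False))"
    by (intro cdim_free_amalgam) (simp_all add: one)
  then show ?thesis
    using cdim_hom_image[OF im1 group_P] cdim_hom_image[OF im2 group_P]
      zz_hom_image[OF im1 group_P] zz_hom_image[OF im2 group_P]
    by (simp add: factors_def free_product_eq_amalgamated_product)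
qed

text \<open>The groups may have different element types, so \<open>G1\<close> being contained in
  \<open>G2\<close> is expressed by an isomorphism onto a subgroup. The premises on trivial carriers
  in the third conjunct rule out the degenerate free products for which the formula fails.\<close>

theorem proposition3p6:
  fixes G1 :: "('a, 'm) monoid_scheme" and G2 :: "('b, 'n) monoid_scheme"
  assumes "group G1" and "group G2"
    and "cdim G1 \<noteq> \<infinity>" and "cdim G2 \<noteq> \<infinity>"
  shows
    "(\<forall>H. subgroup H G2 \<longrightarrow> G1 \<cong> G2\<lparr>carrier := H\<rparr> \<longrightarrow> cdim G1 \<le> cdim G2)
   \<and> cdim (G1 \<times>\<times> G2) = cdim G1 + cdim G2
   \<and> ((carrier G1 = {\<one>\<^bsub>G1\<^esub>} \<longrightarrow> centre G2 = {\<one>\<^bsub>G2\<^esub>}) \<longrightarrow>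
      (carrier G2 = {\<one>\<^bsub>G2\<^esub>} \<longrightarrow> centre G1 = {\<one>\<^bsub>G1\<^esub>}) \<longrightarrow>
      cdim (free_product G1 G2) = max (cdim G1 + zz G1) (cdim G2 + zz G2))
   \<and> (\<forall>\<phi>. \<not> comm_group G1 \<longrightarrow> \<not> comm_group G2 \<longrightarrow>
      \<phi> \<in> iso (G1\<lparr>carrier := centre G1\<rparr>) (G2\<lparr>carrier := centre G2\<rparr>) \<longrightarrow>
      centre G2 \<noteq> {\<one>\<^bsub>G2\<^esub>} \<longrightarrow>
      cdim (amalgamated_product G1 G2 (centre G1) \<phi>) = max (cdim G1) (cdim G2))"
proof (intro conjI allI impI)
  fix H assume "subgroup H G2" "G1 \<cong> G2\<lparr>carrier := H\<rparr>"
  then show "cdim G1 \<le> cdim G2"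
    using cdim_mono_is_iso[OF _ assms(1)] cdim_mono_subgroup[OF assms(2)] order_trans by blast
next
  show "cdim (G1 \<times>\<times> G2) = cdim G1 + cdim G2" by (rule cdim_DirProd[OF assms(1,2)])
qed (rule cdim_free_product[OF assms(1,2)] cdim_amalgamated_product_centres[OF assms(1,2)]; simp)+

end
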